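(* Let $(x_n)$ and $(x_n^* )$ be normalized weakly null sequences in a real Banach space $X$ and in $X^*$ respectively. Assume that for some $\epsilon>0$ we have $\inf_n|x_n^*(x_n)|\ge\epsilon$. Let $1\le\xi<\omega_1$. The following are equivalent: (1) For every $M\in[\mathbb N]$ there exists $L\in[M]$ such that $(x_n^*|_{X_M})_{n\in L}$ is an $\ell_1^{\xi}$ spreading model. (2) For every $M\in[\mathbb N]$ there exists $L\in[M]$ such that $(x_n)_{n\in L}$ is a $c_0^{\xi}$ spreading model.
   Context: $[M]$ is the set of infinite subsets of $M$; for $L=(l_i)$ (increasing) the sequence $(z_n)_{n\in L}$ means $(z_{l_i})_{i\in\mathbb N}$. $X_M$ denotes the closed linear span of $(x_n)_{n\in M}$, and $x^*|_{X_M}$ the restriction of $x^*$ to $X_M$. For each countable ordinal $\xi$ fix successor ordinals $(\beta_n(\xi)+1)_n$: equal to $\xi$ if $\xi$ is a successor, strictly increasing to $\xi$ if $\xi$ is a limit. Schreier families: $S_0=\{\{n\}:n\in\mathbb N\}\cup\{\emptyset\}$; $S_{\zeta+1}=\{\bigcup_{i=1}^nF_i:n\le\min F_1,\ F_1<\cdots<F_n,\ F_i\in S_\zeta\}\cup\{\emptyset\}$ ($F<G$ means $\max F<\min G$); for limit $\xi$, $S_\xi=\{F:F\in S_{\beta_n(\xi)+1}\text{ for some }n\le\min F\}$. A semi-normalized $(y_i)$ is an $\ell_1^\xi$ spreading model if there is $c>0$ with $\|\sum_{i\in F}a_iy_i\|\ge c\sum_{i\in F}|a_i|$ for all $F\in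 S_\xi$ and scalars. $(y_i)$ is a $c_0^\xi$ spreading model if there is $C>0$ with $\|\sum_{i\in F}a_iy_i\|\le C\max_{i\in F}|a_i|$ for all $F\in S_\xi$ and scalars. *)

theory Defs
  imports "HOL-Analysis.Analysis" "HOL-Library.Infinite_Set"
begin

section \<open>Countable ordinals, modelled as elements of a well-ordered type\<close>

definition osuc :: "'o::wellorder \<Rightarrow> 'o" where
  "osuc \<eta> = (LEAST \<zeta>. \<eta> < \<zeta>)"

definition is_zero_ord :: "'o::wellorder \<Rightarrow> bool" where
  "is_zero_ord \<xi> \<longleftrightarrow> \<not> (\<exists>\<eta>. \<eta> < \<xi>)"

definition is_succ_ord :: "'o::wellorder \<Rightarrow> bool" where
  "is_succ_ord \<xi> \<longleftrightarrow> (\<exists>\<eta><\<xi>. \<forall>\<zeta>. \<eta> < \<zeta> \<longrightarrow> \<xi> \<le> \<zeta>)"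

definition is_limit_ord :: "'o::wellorder \<Rightarrow> bool" where
  "is_limit_ord \<xi> \<longleftrightarrow> \<not> is_zero_ord \<xi> \<and> \<not> is_succ_ord \<xi>"

definition opred :: "'o::wellorder \<Rightarrow> 'o" where
  "opred \<xi> = (THE \<eta>. \<eta> < \<xi> \<and> (\<forall>\<zeta>. \<eta> < \<zeta> \<longrightarrow> \<xi> \<le> \<zeta>))"

definition valid_beta :: "('o::wellorder \<Rightarrow> nat \<Rightarrow> 'o) \<Rightarrow> 'o \<Rightarrow> bool" where
  "valid_beta \<beta> \<xi> \<longleftrightarrow>
     (\<forall>\<eta>\<le>\<xi>. is_succ_ord \<eta> \<longrightarrow> (\<forall>n\<ge>1. \<beta> \<eta> n < \<eta> \<and> osuc (\<beta> \<eta> n) = \<eta>)) \<and>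
     (\<forall>\<eta>\<le>\<xi>. is_limit_ord \<eta> \<longrightarrow>
        (\<forall>n\<ge>1. \<beta> \<eta> n < \<eta> \<and> osuc (\<beta> \<eta> n) < osuc (\<beta> \<eta> (Suc n))) \<and>
        (\<forall>\<zeta><\<eta>. \<exists>n\<ge>1. \<zeta> < osuc (\<beta> \<eta> n)))"

definition set_less :: "nat set \<Rightarrow> nat set \<Rightarrow> bool" where
  "set_less A B \<longleftrightarrow> (\<forall>a\<in>A. \<forall>b\<in>B. a < b)"

definition schreier_step ::
  "('o::wellorder \<Rightarrow> nat \<Rightarrow> 'o) \<Rightarrow> ('o \<Rightarrow> nat set set) \<Rightarrow> 'o \<Rightarrow> nat set set" where
  "schreier_step \<beta> S \<xi> =
     (if is_zero_ord \<xi> then {{n} | n. 1 \<le> n} \<union> {{}}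
      else if is_succ_ord \<xi> then
        {G. \<exists>Fs. Fs \<noteq> [] \<and> (\<forall>F\<in>set Fs. F \<in> S (opred \<xi>) \<and> F \<noteq> {}) \<and>
              sorted_wrt set_less Fs \<and> length Fs \<le> Min (hd Fs) \<and> G = \<Union> (set Fs)} \<union> {{}}
      else {F. F = {} \<or> (\<exists>n. 1 \<le> n \<and> n \<le> Min F \<and> F \<in> S (osuc (\<beta> \<xi> n)))})"

definition schreier :: "('o::wellorder \<Rightarrow> nat \<Rightarrow> 'o) \<Rightarrow> 'o \<Rightarrow> nat set set" where
  "schreier \<beta> = wfrec {(a, b). a < b} (schreier_step \<beta>)"

text \<open>(z_n)_{n in L}, indexed from 1: position i >= 1 is z (l_i).\<close>
definition subseq_on :: "nat set \<Rightarrow> (nat \<Rightarrow> 'b) \<Rightarrow> nat \<Rightarrow> 'b" where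
  "subseq_on L z = (\<lambda>i. z (enumerate L (i - 1)))"

definition seminormalized :: "('b \<Rightarrow> real) \<Rightarrow> (nat \<Rightarrow> 'b) \<Rightarrow> bool" where
  "seminormalized nrm y \<longleftrightarrow> (\<exists>c C. 0 < c \<and> (\<forall>i\<ge>1. c \<le> nrm (y i) \<and> nrm (y i) \<le> C))"

definition ell1_spreading :: "nat set set \<Rightarrow> ('b::real_vector \<Rightarrow> real) \<Rightarrow> (nat \<Rightarrow> 'b) \<Rightarrow> bool" where
  "ell1_spreading SF nrm y \<longleftrightarrow> seminormalized nrm y \<and>
     (\<exists>c>0. \<forall>F\<in>SF. \<forall>a::nat\<Rightarrow>real. nrm (\<Sum>i\<in>F. a i *\<^sub>R y i) \<ge> c * (\<Sum>i\<in>F. \<bar>a i\<bar>))"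

definition c0_spreading :: "nat set set \<Rightarrow> ('b::real_vector \<Rightarrow> real) \<Rightarrow> (nat \<Rightarrow> 'b) \<Rightarrow> bool" where
  "c0_spreading SF nrm y \<longleftrightarrow> seminormalized nrm y \<and>
     (\<exists>C>0. \<forall>F\<in>SF. F \<noteq> {} \<longrightarrow> (\<forall>a::nat\<Rightarrow>real.
         nrm (\<Sum>i\<in>F. a i *\<^sub>R y i) \<le> C * Max ((\<lambda>i. \<bar>a i\<bar>) ` F)))"

definition weakly_null :: "(nat \<Rightarrow> 'a::real_normed_vector) \<Rightarrow> bool" where
  "weakly_null x \<longleftrightarrow> (\<forall>f::'a \<Rightarrow> real. bounded_linear f \<longrightarrow> (\<lambda>n. f (x n)) \<longlonglongrightarrow> 0)"

definition closed_span_on :: "(nat \<Rightarrow> 'a::real_normed_vector) \<Rightarrow> nat set \<Rightarrow> 'a set" where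
  "closed_span_on x M = closure (span (x ` M))"

definition restr_norm :: "'a::real_normed_vector set \<Rightarrow> ('a \<Rightarrow>\<^sub>L real) \<Rightarrow> real" where
  "restr_norm V f = (SUP z\<in>{z \<in> V. norm z \<le> 1}. \<bar>blinfun_apply f z\<bar>)"

end

theory Submission
  imports Defs
begin

text \<open>
  From (2) to (1): on a subsequence along which the matrix \<open>xs m (x n)\<close> is nearly diagonal, a
  combination of the \<open>xs n\<close> is tested against the vector \<open>\<Sum> \<plusminus>x n\<close>, whose norm the \<open>c\<^sub>0\<close> estimate
  bounds.

  From (1) to (2): by Elton's theorem a weakly null sequence has a subsequence \<open>N\<close> on which
  restricting a vector with bounded coefficients to coordinates of size at least \<open>\<delta>\<close> costs only a
  constant depending on \<open>\<delta>\<close>. Apply (1) to \<open>N\<close>. For a Schreier set \<open>A\<close>, the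
  \<open>\<ell>\<^sub>1\<close> estimate with constant \<open>c\<close> yields, by duality, vectors of the unit ball of \<open>X\<^sub>N\<close> on which the
  \<open>xs n\<close>, \<open>n \<in> A\<close>, take approximately the values \<open>\<plusminus>c\<close> with prescribed signs. Near diagonality turns
  this into coefficients of size at least \<open>c/2\<close> on \<open>A\<close>, and Elton's theorem permits to restrict to \<open>A\<close>.

  Elton's theorem rests on a Ramsey argument: if a functional of norm at most 1 is nonnegative on
  \<open>x n\<close>, \<open>n \<in> G\<close>, with large sum, then (after passing to a subsequence, and possibly to an initial
  segment of \<open>G\<close>) another such functional is in addition nearly zero off \<open>G\<close>.
\<close>

section \<open>Infinite Ramsey theory\<close>

definition above :: "nat set \<Rightarrow> nat set \<Rightarrow> nat set" where
  "above s N = {n \<in> N. \<forall>p\<in>s. p < n}"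

lemma above_subset: "above s N \<subseteq> N"
  by (auto simp: above_def)

lemma above_mono: "N \<subseteq> N' \<Longrightarrow> above s N \<subseteq> above s N'"
  by (auto simp: above_def)

lemma above_empty [simp]: "above {} N = N"
  by (auto simp: above_def)

lemma infinite_above:
  assumes "finite s" "infinite N"
  shows "infinite (above s N)"
proof -
  obtain m where m: "\<forall>p\<in>s. p \<le> m"
    using assms(1) by (meson finite_nat_set_iff_bounded_le)
  have "N \<subseteq> above s N \<union> {..m}"
    using m by (force simp: above_def)
  then show ?thesis
    using assms(2) by (meson finite_Un finite_atMost finite_subset)
qed

text \<open>The minima \<open>m n\<close> of a decreasing sequence of infinite sets
  \<open>K n\<close> form \<open>N\<close>. Passing to \<open>K (Suc n)\<close> settles every subset
  of \<open>{..m n}\<close>, so the construction need not remember the points chosen earlier. If a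
  finite \<open>s\<close> has maximum \<open>m k\<close>, all later points of \<open>N\<close> lie
  in \<open>K (Suc k)\<close>, where \<open>Q s\<close> was secured; heredity does the rest.\<close>

lemma fusion:
  fixes Q :: "nat set \<Rightarrow> nat set \<Rightarrow> bool"
  assumes hereditary: "\<And>s N N'. Q s N \<Longrightarrow> N' \<subseteq> N \<Longrightarrow> Q s N'"
    and dense: "\<And>s N. finite s \<Longrightarrow> infinite N \<Longrightarrow> set_less s N \<Longrightarrow> \<exists>N'\<subseteq>N. infinite N' \<and> Q s N'"
    and "infinite M"
  shows "\<exists>N\<subseteq>M. infinite N \<and> (\<forall>s\<subseteq>N. finite s \<longrightarrow> Q s (above s N))"
proof -
  have dense_all: "\<exists>N'\<subseteq>N. infinite N' \<and> (\<forall>s\<in>T. Q s N')"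
    if "finite T" "infinite N" "\<forall>s\<in>T. finite s \<and> set_less s N" for T N
    using that
  proof (induction T arbitrary: N rule: finite_induct)
    case empty
    then show ?case by auto
  next
    case (insert s T)
    then obtain N1 where N1: "N1 \<subseteq> N" "infinite N1" "\<forall>t\<in>T. Q t N1"
      by (metis insertCI)
    then have "finite s" "set_less s N1"
      using insert.prems by (auto simp: set_less_def)
    then obtain N2 where N2: "N2 \<subseteq> N1" "infinite N2" "Q s N2"
      using dense[OF _ N1(2)] by blast
    then have "\<forall>t\<in>insert s T. Q t N2"
      using N1(3) hereditary[OF _ N2(1)] by blast
    then show ?case
      using N1(1) N2 order_trans by blast
  qed
  let ?m = "\<lambda>K::nat set. LEAST n. n \<in> K"
  \<comment> \<open>The clause for \<open>n = 0\<close> serves \<open>s = {}\<close>: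
    \<open>above {} N\<close> is all of \<open>N\<close>, including the least element of
    \<open>K 0\<close>, which no later set contains.\<close>
  obtain K where K: "\<And>n. infinite (K n) \<and> (n = 0 \<longrightarrow> K n \<subseteq> M \<and> Q {} (K n))"
    and step: "\<And>n. K (Suc n) \<subseteq> above {?m (K n)} (K n) \<and> (\<forall>s\<subseteq>{..?m (K n)}. Q s (K (Suc n)))"
  proof (atomize_elim, rule exE[OF dependent_nat_choice
        [where P = "\<lambda>n K. infinite K \<and> (n = 0 \<longrightarrow> K \<subseteq> M \<and> Q {} K)"
           and Q = "\<lambda>_ K K'. K' \<subseteq> above {?m K} K \<and> (\<forall>s\<subseteq>{..?m K}. Q s K')"]], goal_cases)
    case 1
    then show ?case
      using dense[of "{}" M] assms(3) by (auto simp: set_less_def)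
  next
    case (2 K n)
    then have "infinite (above {?m K} K)"
      by (intro infinite_above) auto
    then obtain K' where "K' \<subseteq> above {?m K} K" "infinite K'" "\<forall>s\<in>Pow {..?m K}. Q s K'"
      using dense_all[of "Pow {..?m K}" "above {?m K} K"]
      by (force simp: set_less_def above_def finite_subset)
    then show ?case by auto
  next
    case (3 f)
    then show ?case by blast
  qed
  define m where "m n = ?m (K n)" for n
  have mK: "m n \<in> K n" for n
    unfolding m_def using K[of n] by (metis LeastI infinite_imp_nonempty equals0I)
  have Ksub: "K (Suc n) \<subseteq> K n" for n
    using step[of n] above_subset[of "{?m (K n)}" "K n"] by (blast intro: order_trans)
  have Kdec: "K j \<subseteq> K i" if "i \<le> j" for i j
    using that by (induction rule: dec_induct) (use Ksub in auto)
  have mless: "m i < n" if "n \<in> K (Suc i)" for i n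
    using that step[of i] by (auto simp: above_def m_def)
  have strict: "strict_mono m"
    by (intro strict_mono_Suc_iff[THEN iffD2] allI mless mK)
  have "Q s (above s (range m))" if s: "s \<subseteq> range m" "finite s" for s
  proof (cases "s = {}")
    case True
    have "range m \<subseteq> K 0"
      using mK Kdec by blast
    then show ?thesis
      using True K[of 0] hereditary[of "{}" "K 0"] by simp
  next
    case False
    then have "Max s \<in> s"
      using s(2) by simp
    then obtain k where k: "Max s = m k"
      using s(1) by blast
    have "above s (range m) \<subseteq> K (Suc k)"
    proof
      fix n assume n: "n \<in> above s (range m)"
      then obtain j where j: "n = m j"
        by (auto simp: above_def)
      have "m k < m j"
        using n \<open>Max s \<in> s\<close> k j by (auto simp: above_def)
      then have "Suc k \<le> j"
        using strict by (simp add: strict_mono_less)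
      then show "n \<in> K (Suc k)"
        using mK[of j] Kdec[of "Suc k" j] j by blast
    qed
    moreover have "s \<subseteq> {..m k}"
      using Max_ge[OF s(2)] k by auto
    then have "Q s (K (Suc k))"
      using step[of k] unfolding m_def by blast
    ultimately show ?thesis
      by (rule hereditary[rotated])
  qed
  moreover have "range m \<subseteq> M"
  proof
    fix k assume "k \<in> range m"
    then obtain j where "k = m j" by blast
    then have "k \<in> K 0"
      using mK[of j] Kdec[of 0 j] by auto
    then show "k \<in> M" using K[of 0] by auto
  qed
  moreover have "infinite (range m)"
    by (rule range_inj_infinite[OF strict_mono_imp_inj_on[OF strict]])
  ultimately show ?thesis
    by (intro exI[of _ "range m"] conjI allI impI)
qed

section \<open>The Nash-Williams dichotomy for families of finite sets\<close>

definition initseg :: "nat set \<Rightarrow> nat set \<Rightarrow> bool" where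
  "initseg t L \<longleftrightarrow> (\<exists>n. t = L \<inter> {..<n})"

lemma initseg_Un_left:
  assumes "finite s" "set_less s L"
  shows "initseg s (s \<union> L)"
proof (cases "s = {}")
  case True
  then show ?thesis by (auto simp: initseg_def intro!: exI[of _ 0])
next
  case False
  then have "Max s < l" if "l \<in> L" for l
    using assms(2) Max_in[OF assms(1)] that by (simp add: set_less_def)
  then have "s = (s \<union> L) \<inter> {..<Suc (Max s)}"
    using Max_ge[OF assms(1)] by (fastforce simp: less_Suc_eq_le)
  then show ?thesis unfolding initseg_def by blast
qed

text \<open>Galvin's form of the Nash-Williams theorem, by accepting and rejecting. A fusion makes
  every finite \<open>s\<close> in \<open>N1\<close> decided. If \<open>{}\<close> is accepted, the
  first alternative holds. Otherwise a rejected \<open>s\<close> has only finitely many one-point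
  extensions that are not rejected, and a second fusion avoids these, so that every finite subset of
  \<open>N2\<close> is rejected. A member of \<open>F\<close> is always accepted, hence none lies in
  \<open>N2\<close>.\<close>

lemma nash_williams:
  assumes "infinite M"
  shows "\<exists>N\<subseteq>M. infinite N \<and>
    ((\<forall>L\<subseteq>N. infinite L \<longrightarrow> (\<exists>t\<in>F. initseg t L)) \<or> (\<forall>t\<subseteq>N. finite t \<longrightarrow> t \<notin> F))"
proof -
  define acc where "acc s N \<longleftrightarrow>
      (\<forall>L\<subseteq>N. infinite L \<and> set_less s L \<longrightarrow> (\<exists>t\<in>F. initseg t (s \<union> L)))" for s N
  define rejects where "rejects s N \<longleftrightarrow> (\<forall>N'\<subseteq>N. infinite N' \<longrightarrow> \<not> acc s N')" for s N
  have acc_mono: "acc s N'" if "acc s N" "N' \<subseteq> N" for s N N'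
    using that by (auto simp: acc_def)
  have rej_mono: "rejects s N'" if "rejects s N" "N' \<subseteq> N" for s N N'
    using that by (auto simp: rejects_def)
  obtain N1 where N1: "N1 \<subseteq> M" "infinite N1"
    and dec: "\<And>s. s \<subseteq> N1 \<Longrightarrow> finite s \<Longrightarrow> acc s (above s N1) \<or> rejects s (above s N1)"
  proof (atomize_elim, insert fusion[of "\<lambda>s N. acc s N \<or> rejects s N" M], goal_cases)
    case 1
    have "\<exists>N\<subseteq>M. infinite N \<and> (\<forall>s\<subseteq>N. finite s \<longrightarrow> acc s (above s N) \<or> rejects s (above s N))"
    proof (rule 1[OF _ _ assms])
      show "acc s N' \<or> rejects s N'" if "acc s N \<or> rejects s N" "N' \<subseteq> N" for s N N'
        using that(1) acc_mono[OF _ that(2)] rej_mono[OF _ that(2)] by blast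
      show "\<exists>N'\<subseteq>N. infinite N' \<and> (acc s N' \<or> rejects s N')" if "infinite N" for s N
        using that unfolding rejects_def by blast
    qed
    then show ?case by (elim exE conjE) blast
  qed
  define rej where "rej s \<longleftrightarrow> rejects s (above s N1)" for s
  show ?thesis
  proof (cases "rej {}")
    case False
    then have "acc {} N1"
      using dec[of "{}"] by (auto simp: rej_def)
    then show ?thesis
      using N1 by (intro exI[of _ N1]) (auto simp: acc_def set_less_def)
  next
    case True
    let ?Q = "\<lambda>s N. s \<subseteq> N1 \<longrightarrow> rej s \<longrightarrow> (\<forall>n\<in>N \<inter> above s N1. rej (insert n s))"
    have dense: "\<exists>N'\<subseteq>N. infinite N' \<and> ?Q s N'" if s: "finite s" "infinite N" for s N
    proof (cases "s \<subseteq> N1 \<and> rej s")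
      case False
      then show ?thesis using s by auto
    next
      case sN1: True
      define A where "A = {n \<in> above s N1. \<not> rej (insert n s)}"
      \<comment> \<open>An infinite \<open>L\<close> in \<open>A\<close> splits into its least
        element \<open>n\<close> and a rest, and the rest continues the accepted set
        \<open>insert n s\<close>. As \<open>s\<close> is rejected, \<open>A\<close> must then be
        finite.\<close>
      have "acc s A"
        unfolding acc_def
      proof (intro allI impI, elim conjE)
        fix L assume L: "L \<subseteq> A" "infinite L" "set_less s L"
        define n where "n = (LEAST n. n \<in> L)"
        have n: "n \<in> L" "\<And>k. k \<in> L \<Longrightarrow> n \<le> k"
          unfolding n_def using L(2)
          by (metis LeastI infinite_imp_nonempty equals0I, auto intro: Least_le)
        then have "n \<in> N1" "\<not> rej (insert n s)"
          using L by (auto simp: A_def above_def)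
        then have "acc (insert n s) (above (insert n s) N1)"
          using dec[of "insert n s"] sN1 s by (auto simp: rej_def)
        moreover have "L - {n} \<subseteq> above (insert n s) N1"
          using L n by (force simp: A_def above_def)
        moreover have "infinite (L - {n})" "set_less (insert n s) (L - {n})"
          using L n by (auto simp: set_less_def order.not_eq_order_implies_strict)
        moreover have "insert n s \<union> (L - {n}) = s \<union> L"
          using n by auto
        ultimately show "\<exists>t\<in>F. initseg t (s \<union> L)"
          unfolding acc_def by metis
      qed
      moreover have "A \<subseteq> above s N1" by (auto simp: A_def)
      ultimately have "finite A"
        using sN1 by (auto simp: rej_def rejects_def)
      then have "infinite (N - A)" using s by auto
      then show ?thesis
        by (intro exI[of _ "N - A"]) (auto simp: A_def)
    qed
    have "\<exists>N\<subseteq>N1. infinite N \<and> (\<forall>s\<subseteq>N. finite s \<longrightarrow> ?Q s (above s N))"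
      by (rule fusion[OF _ dense N1(2)]) auto
    then obtain N2 where N2: "N2 \<subseteq> N1" "infinite N2"
      and Q: "\<And>s. s \<subseteq> N2 \<Longrightarrow> finite s \<Longrightarrow> ?Q s (above s N2)"
      by blast
    have rej_all: "rej s" if "finite s" "s \<subseteq> N2" for s
      using that
    proof (induction s rule: finite_linorder_max_induct)
      case empty
      then show ?case using True by simp
    next
      case (insert n s)
      then have "n \<in> above s N2 \<inter> above s N1"
        using N2 by (auto simp: above_def)
      then show ?case
        using insert Q[of s] N2 by auto
    qed
    have "t \<notin> F" if t: "t \<subseteq> N2" "finite t" for t
    proof
      assume "t \<in> F"
      then have "acc t (above t N2)"
        using initseg_Un_left t by (auto simp: acc_def)
      then show False
        using rej_all[OF t(2,1)] infinite_above[OF t(2) N2(2)] above_mono[OF N2(1)]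
        by (auto simp: rej_def rejects_def)
    qed
    then show ?thesis
      using N1 N2 by (intro exI[of _ N2]) auto
  qed
qed

section \<open>Matching lemma\<close>

definition thin :: "nat set set \<Rightarrow> bool" where
  "thin \<B> \<longleftrightarrow> (\<forall>s\<in>\<B>. \<forall>t\<in>\<B>. initseg s t \<longrightarrow> s = t)"

text \<open>Two initial segments of \<open>L\<close> are nested, hence so are their unions with
  \<open>s\<close>, and thinness leaves only equality. In \<open>good_extend\<close> this makes
  different points share one witness.\<close>

lemma thin_initseg_unique:
  assumes "thin \<B>" "finite s" "set_less s L" "initseg t L" "initseg t' L" "s \<union> t \<in> \<B>" "s \<union> t' \<in> \<B>"
  shows "t = t'"
proof -
  have aux: "t = t'" if t: "t = L \<inter> {..<n}" and t': "t' = L \<inter> {..<n'}" and "n \<le> n'"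
    and B: "s \<union> t \<in> \<B>" "s \<union> t' \<in> \<B>" for t t' n n'
  proof -
    \<comment> \<open>The cut at \<open>n\<close> might remove part of \<open>s\<close>, so it is
      raised past \<open>s\<close>. This admits no further element of \<open>L\<close>, which lies
      wholly above \<open>s\<close>.\<close>
    define m where "m = Max (insert n (Suc ` s))"
    have m: "n \<le> m" "\<And>p. p \<in> s \<Longrightarrow> p < m" "m = n \<or> (\<exists>p\<in>s. m = Suc p)"
      using assms(2) Max_in[of "insert n (Suc ` s)"] by (auto simp: m_def Suc_le_eq[symmetric])
    have "l < n" if "l \<in> L" "l < m" for l
    proof (cases "m = n")
      case False
      then obtain p where "p \<in> s" "m = Suc p" using m(3) by blast
      then show ?thesis
        using assms(3) that by (fastforce simp: set_less_def)
    qed (use that in simp)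
    then have "L \<inter> {..<n'} \<inter> {..<m} = L \<inter> {..<n}"
      using m(1) \<open>n \<le> n'\<close> by auto
    moreover have "s \<inter> {..<m} = s"
      using m(2) by blast
    ultimately have "s \<union> t = (s \<union> t') \<inter> {..<m}"
      by (simp add: t t' Int_Un_distrib2)
    then have "initseg (s \<union> t) (s \<union> t')"
      unfolding initseg_def by (rule exI)
    then have "s \<union> t = s \<union> t'"
      using B assms(1) unfolding thin_def by blast
    moreover have "s \<inter> t = {}" "s \<inter> t' = {}"
      using assms(3) t t' by (auto simp: set_less_def)
    ultimately show ?thesis by blast
  qed
  obtain n n' where "t = L \<inter> {..<n}" "t' = L \<inter> {..<n'}"
    using assms(4,5) by (auto simp: initseg_def)
  then show ?thesis
    using aux[of t n t' n'] aux[of t' n' t n] assms(6,7) by (cases "n \<le> n'") auto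
qed

text \<open>The budget \<open>1 - (1/2) ^ card H\<close> leaves room for one further small coordinate whenever an
  element is added to \<open>H\<close>.\<close>

definition good ::
  "nat set set \<Rightarrow> (nat set \<Rightarrow> (nat \<Rightarrow> real) set) \<Rightarrow> nat set \<Rightarrow> nat set \<Rightarrow> nat set \<Rightarrow> bool" where
  "good \<B> W G H N \<longleftrightarrow> (\<forall>t\<subseteq>N. finite t \<longrightarrow> G \<union> t \<in> \<B> \<longrightarrow>
     (\<exists>w\<in>W (G \<union> t). (\<Sum>h\<in>H. \<bar>w h\<bar>) \<le> 1 - (1/2) ^ card H))"

lemma good_mono: "good \<B> W G H N \<Longrightarrow> N' \<subseteq> N \<Longrightarrow> good \<B> W G H N'"
  unfolding good_def by blast

text \<open>The form in which weak nullness enters the combinatorics: one finite test set has to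
  serve all functionals at once, which weak* compactness provides.\<close>

definition uniformly_small :: "(nat \<Rightarrow> real) set \<Rightarrow> bool" where
  "uniformly_small V \<longleftrightarrow>
     (\<forall>P \<delta>. infinite P \<longrightarrow> \<delta> > 0 \<longrightarrow> (\<exists>Q\<subseteq>P. finite Q \<and> (\<forall>w\<in>V. \<exists>q\<in>Q. \<bar>w q\<bar> \<le> \<delta>)))"

text \<open>One step of \<open>matching\<close>, in which \<open>H\<close> grows by a point
  \<open>p\<close>. The failures for \<open>p\<close> are the continuations in \<open>F p\<close>.
  On a suitable subset Nash-Williams leaves either no failure, which yields \<open>good\<close>, or
  a failure as initial segment of every infinite subset, which is \<open>bad\<close>. Only finitely
  many \<open>p\<close> are bad, and they are removed.\<close>

lemma good_extend:
  assumes "thin \<B>" and small: "uniformly_small (\<Union>G\<in>\<B>. W G)"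
    and "finite G" "finite H" "infinite L" "set_less G L" "set_less H L"
    and good: "good \<B> W G H L"
  shows "\<exists>L'\<subseteq>L. infinite L' \<and> (\<forall>p\<in>L'. good \<B> W G (insert p H) (above {p} L'))"
proof -
  define F where "F p = {t. G \<union> t \<in> \<B> \<and>
    \<not> (\<exists>w\<in>W (G \<union> t). (\<Sum>h\<in>insert p H. \<bar>w h\<bar>) \<le> 1 - (1/2) ^ card (insert p H))}" for p
  have goodI: "good \<B> W G (insert p H) N" if "\<forall>t\<subseteq>N. finite t \<longrightarrow> t \<notin> F p" for p N
    using that by (auto simp: F_def good_def)
  define bad where "bad p N \<longleftrightarrow> (\<forall>L\<subseteq>N. infinite L \<longrightarrow> (\<exists>t\<in>F p. initseg t L))" for p N
  have bad_mono: "bad p N'" if "bad p N" "N' \<subseteq> N" for p N N'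
    using that unfolding bad_def by (meson subset_trans)
  have step_mono: "bad p N' \<or> good \<B> W G (insert p H) N'"
    if "bad p N \<or> good \<B> W G (insert p H) N" "N' \<subseteq> N" for p N N'
    using that bad_mono good_mono by blast
  let ?Q = "\<lambda>s N. \<forall>p\<in>s. bad p N \<or> good \<B> W G (insert p H) N"
  have "\<exists>N\<subseteq>L. infinite N \<and> (\<forall>s\<subseteq>N. finite s \<longrightarrow> ?Q s (above s N))"
  proof (rule fusion[OF _ _ \<open>infinite L\<close>])
    show "?Q s N'" if Q: "?Q s N" and N': "N' \<subseteq> N" for s N N'
      using Q step_mono[OF _ N'] by blast
    show "\<exists>N'\<subseteq>N. infinite N' \<and> ?Q s N'" if "finite s" "infinite N" for s N
      using that
    proof (induction s arbitrary: N rule: finite_induct)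
      case empty
      then show ?case by auto
    next
      case (insert p s)
      obtain N1 where N1: "N1 \<subseteq> N" "infinite N1" "?Q s N1"
        using insert by blast
      obtain N2 where N2: "N2 \<subseteq> N1" "infinite N2"
        "bad p N2 \<or> (\<forall>t\<subseteq>N2. finite t \<longrightarrow> t \<notin> F p)"
        unfolding bad_def using nash_williams[OF N1(2), of "F p"] by blast
      have "bad p N2 \<or> good \<B> W G (insert p H) N2"
        using N2(3) goodI[of N2 p] by blast
      moreover have "?Q s N2"
        using N1(3) step_mono[OF _ N2(1)] by blast
      ultimately show ?case
        using N1 N2 by (intro exI[of _ N2]) auto
    qed
  qed
  then obtain N where N: "N \<subseteq> L" "infinite N" and "\<forall>s\<subseteq>N. finite s \<longrightarrow> ?Q s (above s N)"
    by (elim exE conjE)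
  then have Q: "bad p (above {p} N) \<or> good \<B> W G (insert p H) (above {p} N)" if "p \<in> N" for p
    using that by (elim allE[of _ "{p}"]) simp
  let ?P = "{p \<in> N. bad p (above {p} N)}"
  \<comment> \<open>One functional would be large at every point of a finite set on which every functional in play is
    small somewhere: by thinness, all bad points of that set have the same witness \<open>t\<close>.\<close>
  have "finite ?P"
  proof (rule ccontr)
    assume "infinite ?P"
    then obtain Q where Q: "Q \<subseteq> ?P" "finite Q"
      and small_Q: "\<And>w G. G \<in> \<B> \<Longrightarrow> w \<in> W G \<Longrightarrow> \<exists>q\<in>Q. \<bar>w q\<bar> \<le> (1/2) ^ Suc (card H)"
      using small[unfolded uniformly_small_def, rule_format, of ?P "(1/2) ^ Suc (card H)"] by auto
    define K where "K = above Q N"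
    have K: "infinite K" "K \<subseteq> L"
      using infinite_above[OF Q(2) N(2)] above_subset[of Q N] N(1) by (auto simp: K_def)
    have ex: "\<exists>t\<in>F q. initseg t K" if "q \<in> Q" for q
    proof -
      have "K \<subseteq> above {q} N"
        using that by (auto simp: K_def above_def)
      then show ?thesis
        using subsetD[OF Q(1) that] K(1) by (simp add: bad_def)
    qed
    have GK: "set_less G K"
      using assms(6) K(2) by (auto simp: set_less_def)
    show False
    proof (cases "Q = {}")
      \<comment> \<open>With \<open>Q\<close> empty, smallness says that \<open>W\<close> is empty
        on all of \<open>\<B>\<close>, against the functional that \<open>good\<close> supplies for
        a witness \<open>t\<close>.\<close>
      case True
      then have "W G' = {}" if "G' \<in> \<B>" for G'
        using small_Q that by blast
      moreover obtain p where "p \<in> ?P"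
        using \<open>infinite ?P\<close> by (metis (no_types, lifting) equals0I infinite_imp_nonempty)
      then have "\<exists>t\<in>F p. initseg t (above {p} N)"
        using infinite_above[of "{p}" N] N(2) unfolding bad_def by blast
      then obtain t where "G \<union> t \<in> \<B>" "finite t" "t \<subseteq> L"
        using N(1) above_subset by (fastforce simp: F_def initseg_def)
      then have "\<exists>w. w \<in> W (G \<union> t)"
        using good by (auto simp: good_def)
      ultimately show False
        using \<open>G \<union> t \<in> \<B>\<close> by blast
    next
      case False
      then obtain q0 t where t: "q0 \<in> Q" "t \<in> F q0" "initseg t K"
        using ex by blast
      have tF: "t \<in> F q" if q: "q \<in> Q" for q
      proof -
        obtain t' where t': "t' \<in> F q" "initseg t' K"
          using ex[OF q] by blast
        then have "t = t'"
          using t by (intro thin_initseg_unique[OF assms(1,3) GK]) (auto simp: F_def)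
        then show ?thesis using t' by simp
      qed
      have "finite t" "t \<subseteq> L" "G \<union> t \<in> \<B>"
        using t K(2) by (auto simp: initseg_def F_def)
      then obtain w where w: "w \<in> W (G \<union> t)" "(\<Sum>h\<in>H. \<bar>w h\<bar>) \<le> 1 - (1/2) ^ card H"
        using good by (auto simp: good_def)
      obtain q where q: "q \<in> Q" "\<bar>w q\<bar> \<le> (1/2) ^ Suc (card H)"
        using small_Q \<open>G \<union> t \<in> \<B>\<close> w(1) by blast
      have "q \<in> L" using q Q N by auto
      then have "q \<notin> H" using assms(7) by (auto simp: set_less_def)
      then have "(\<Sum>h\<in>insert q H. \<bar>w h\<bar>) \<le> 1 - (1/2) ^ card (insert q H)"
        using w(2) q(2) assms(4) by simp
      then show False
        using tF[OF q(1)] w(1) by (auto simp: F_def)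
    qed
  qed
  then have inf: "infinite (N - ?P)"
    using N(2) by simp
  have "good \<B> W G (insert p H) (above {p} (N - ?P))" if p: "p \<in> N - ?P" for p
  proof (rule good_mono)
    show "good \<B> W G (insert p H) (above {p} N)"
      using Q[of p] p by blast
    show "above {p} (N - ?P) \<subseteq> above {p} N"
      by (rule above_mono) blast
  qed
  then show ?thesis
    using inf N(1) by (intro exI[of _ "N - ?P"]) blast
qed

text \<open>\<open>G\<close> and \<open>H\<close> may interlace, so the elements of their union
  \<open>s\<close> are processed in increasing order. An element of \<open>G\<close> passes from the
  continuation to the part already seen; an element of \<open>H\<close> uses
  \<open>good_extend\<close>. The induction starts from nonemptiness of \<open>W\<close> and is
  finally read with the empty continuation.\<close>

lemma matching:
  assumes thin: "thin \<B>" and small: "uniformly_small (\<Union>G\<in>\<B>. W G)"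
    and nonempty: "\<And>G. G \<in> \<B> \<Longrightarrow> W G \<noteq> {}"
    and "infinite M"
  shows "\<exists>N\<subseteq>M. infinite N \<and> (\<forall>G H. finite G \<and> finite H \<and> G \<subseteq> N \<and> H \<subseteq> N \<and> G \<inter> H = {} \<and> G \<in> \<B> \<longrightarrow>
    (\<exists>w\<in>W G. (\<Sum>h\<in>H. \<bar>w h\<bar>) \<le> 1))"
proof -
  \<comment> \<open>The second alternative lets density hold for every pair, good or not. The
    induction below refutes it, since there goodness on the infinite set \<open>above s N\<close> is
    known.\<close>
  let ?R = "\<lambda>G H N. (\<forall>p\<in>N. good \<B> W G (insert p H) (above {p} N)) \<or>
    (\<forall>L\<subseteq>N. infinite L \<longrightarrow> \<not> good \<B> W G H L)"
  have R_mono: "?R G H N'" if "?R G H N" "N' \<subseteq> N" for G H N N'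
  proof (rule disjE[OF that(1)])
    assume "\<forall>p\<in>N. good \<B> W G (insert p H) (above {p} N)"
    then show ?thesis
      using that(2) good_mono[OF _ above_mono[OF that(2)]] by blast
  next
    assume "\<forall>L\<subseteq>N. infinite L \<longrightarrow> \<not> good \<B> W G H L"
    then show ?thesis
      using that(2) by (meson subset_trans)
  qed
  have R_dense: "\<exists>N'\<subseteq>N. infinite N' \<and> ?R G H N'"
    if "finite G" "finite H" "infinite N" "set_less G N" "set_less H N" for G H N
  proof (cases "\<exists>L\<subseteq>N. infinite L \<and> good \<B> W G H L")
    case True
    then obtain L where L: "L \<subseteq> N" "infinite L" "good \<B> W G H L" by blast
    then have "set_less G L" "set_less H L"
      using that by (auto simp: set_less_def)
    then show ?thesis
      using good_extend[OF thin small that(1,2) L(2) _ _ L(3)] L(1) by (meson subset_trans)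
  next
    case False
    then show ?thesis using that by blast
  qed
  have "\<exists>N\<subseteq>M. infinite N \<and> (\<forall>s\<subseteq>N. finite s \<longrightarrow> (\<forall>G\<in>Pow s. ?R G (s - G) (above s N)))"
  proof (rule fusion[OF _ _ \<open>infinite M\<close>])
    show "\<forall>G\<in>Pow s. ?R G (s - G) N'" if "\<forall>G\<in>Pow s. ?R G (s - G) N" "N' \<subseteq> N" for s N N'
      using that(1) R_mono[OF _ that(2)] by blast
    fix s N :: "nat set" assume s: "finite s" "infinite N" "set_less s N"
    have "\<exists>N'\<subseteq>N. infinite N' \<and> (\<forall>G\<in>\<G>. ?R G (s - G) N')" if "finite \<G>" "\<G> \<subseteq> Pow s" for \<G>
      using that
    proof (induction \<G> rule: finite_induct)
      case empty
      then show ?case using s by auto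
    next
      case (insert G \<G>)
      then obtain N1 where N1: "N1 \<subseteq> N" "infinite N1" "\<forall>G\<in>\<G>. ?R G (s - G) N1"
        by auto
      have "finite G" "set_less G N1" "set_less (s - G) N1"
        using insert.prems s N1(1) finite_subset[of G s] by (auto simp: set_less_def)
      then obtain N2 where "N2 \<subseteq> N1" "infinite N2" "?R G (s - G) N2"
        using R_dense[of G "s - G" N1] s(1) N1(2) by blast
      moreover have "\<forall>G\<in>\<G>. ?R G (s - G) N2"
        using N1(3) R_mono[OF _ \<open>N2 \<subseteq> N1\<close>] by blast
      ultimately show ?case
        using N1(1) by (intro exI[of _ N2]) auto
    qed
    then show "\<exists>N'\<subseteq>N. infinite N' \<and> (\<forall>G\<in>Pow s. ?R G (s - G) N')"
      using s(1) by blast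
  qed
  then obtain N where N: "N \<subseteq> M" "infinite N"
    and R: "\<And>s G. s \<subseteq> N \<Longrightarrow> finite s \<Longrightarrow> G \<subseteq> s \<Longrightarrow> ?R G (s - G) (above s N)"
  proof (elim exE conjE, goal_cases)
    case (1 N)
    show ?case
    proof (rule 1(1)[OF 1(2,3)])
      fix s G assume "s \<subseteq> N" "finite s" "G \<subseteq> s"
      then show "?R G (s - G) (above s N)"
        using 1(4)[THEN spec, of s] by (meson PowI)
    qed
  qed
  have all_good: "good \<B> W G (s - G) (above s N)" if "finite s" "s \<subseteq> N" "G \<subseteq> s" for s G
    using that
  proof (induction s arbitrary: G rule: finite_linorder_max_induct)
    case empty
    then show ?case using nonempty by (auto simp: good_def)
  next
    case (insert p s)
    have p: "p \<in> above s N" "above {p} (above s N) = above (insert p s) N"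
      using insert by (auto simp: above_def)
    have IH: "good \<B> W (G - {p}) (s - (G - {p})) (above s N)"
      using insert.IH[of "G - {p}"] insert.prems by auto
    show ?case
    proof (cases "p \<in> G")
      case True
      have [simp]: "insert p s - G = s - (G - {p})"
        using True insert by auto
      show ?thesis
        unfolding good_def
      proof (intro allI impI)
        fix t assume t: "t \<subseteq> above (insert p s) N" "finite t" "G \<union> t \<in> \<B>"
        \<comment> \<open>A point of \<open>G\<close> costs no budget: it becomes part of the
          continuation in the hypothesis for \<open>G - {p}\<close>, while the set to be kept small
          stays the same.\<close>
        have "insert p t \<subseteq> above s N"
          using t p above_subset by fastforce
        moreover have "(G - {p}) \<union> insert p t = G \<union> t"
          using True by auto
        ultimately show "\<exists>w\<in>W (G \<union> t). (\<Sum>h\<in>insert p s - G. \<bar>w h\<bar>) \<le> 1 - (1/2) ^ card (insert p s - G)"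
          using IH[unfolded good_def, rule_format, of "insert p t"] t by simp
      qed
    next
      case False
      then have G: "G \<subseteq> s" "G - {p} = G" "insert p s - G = insert p (s - G)"
        using insert by auto
      have "infinite (above s N)"
        using insert N by (intro infinite_above) auto
      then have "\<forall>p\<in>above s N. good \<B> W G (insert p (s - G)) (above {p} (above s N))"
        using R[of s G] insert IH G by auto
      then have "good \<B> W G (insert p (s - G)) (above {p} (above s N))"
        using p(1) by (rule bspec)
      then show ?thesis
        by (simp only: p(2) G(3))
    qed
  qed
  have "\<exists>w\<in>W G. (\<Sum>h\<in>H. \<bar>w h\<bar>) \<le> 1"
    if "finite G" "finite H" "G \<subseteq> N" "H \<subseteq> N" "G \<inter> H = {}" "G \<in> \<B>" for G H
  proof -
    have "G \<union> H - G = H" using that by auto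
    then have "\<exists>w\<in>W G. (\<Sum>h\<in>H. \<bar>w h\<bar>) \<le> 1 - (1/2) ^ card H"
      using all_good[of "G \<union> H" G, unfolded good_def, rule_format, of "{}"] that by simp
    moreover have "(0::real) \<le> (1/2) ^ card H" by simp
    ultimately show ?thesis
      by (smt (verit) bexE bexI)
  qed
  then show ?thesis
    using N by (intro exI[of _ N]) blast
qed

section \<open>Norming functionals and weak* compactness\<close>

definition sublin :: "('a::real_vector \<Rightarrow> real) \<Rightarrow> bool" where
  "sublin p \<longleftrightarrow> (\<forall>u v. p (u + v) \<le> p u + p v) \<and> (\<forall>r>0. \<forall>v. p (r *\<^sub>R v) = r * p v)"

lemma sublin_zero:
  assumes "sublin p"
  shows "p 0 = 0"
proof -
  have "p (2 *\<^sub>R 0) = 2 * p 0"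
    using assms by (simp only: sublin_def)
  then show ?thesis by simp
qed

lemma sublin_lower:
  assumes "sublin p"
  shows "- p (- v) \<le> p v"
  using assms sublin_zero[OF assms] unfolding sublin_def
  by (metis add.right_inverse diff_0 diff_le_eq add.commute)

text \<open>A linear \<open>f\<close> below \<open>tilt p y\<close> lies below \<open>p\<close>
  (take \<open>t = 0\<close>) and satisfies \<open>f (- y) \<le> - p y\<close> (take
  \<open>t = 1\<close>), so for sublinear \<open>p\<close> it attains \<open>p\<close> at
  \<open>y\<close>.\<close>

definition tilt :: "('a::real_vector \<Rightarrow> real) \<Rightarrow> 'a \<Rightarrow> 'a \<Rightarrow> real" where
  "tilt p y v = (INF t\<in>{0..}. p (v + t *\<^sub>R y) - t * p y)"

text \<open>The infimum is finite because \<open>- p (- v)\<close> bounds all its terms from below.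
  Shifts \<open>s\<close> and \<open>t\<close> combine to \<open>s + t\<close> in the triangle
  inequality, and scaling by \<open>r\<close> turns the shift \<open>t\<close> into
  \<open>r * t\<close>.\<close>

lemma
  assumes p: "sublin p"
  shows sublin_tilt: "sublin (tilt p y)"
    and tilt_le: "t \<ge> 0 \<Longrightarrow> tilt p y v \<le> p (v + t *\<^sub>R y) - t * p y"
proof -
  have add: "p (u + v) \<le> p u + p v" for u v
    using p by (auto simp: sublin_def)
  have scale: "p (r *\<^sub>R v) = r * p v" if "r \<ge> 0" for r v
    using p that sublin_zero[OF p] by (cases "r = 0") (auto simp: sublin_def)
  have lower: "- p (- v) \<le> p (v + t *\<^sub>R y) - t * p y" if "t \<ge> 0" for v t
    using add[of "v + t *\<^sub>R y" "- v"] scale[OF that, of y] by simp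
  then have bdd: "bdd_below ((\<lambda>t. p (v + t *\<^sub>R y) - t * p y) ` {0..})" for v
    by (intro bdd_belowI2[where m = "- p (- v)"]) auto
  show le: "t \<ge> 0 \<Longrightarrow> tilt p y v \<le> p (v + t *\<^sub>R y) - t * p y" for v t
    unfolding tilt_def by (rule cINF_lower[OF bdd]) auto
  have ge: "c \<le> tilt p y v" if "\<And>t. t \<ge> 0 \<Longrightarrow> c \<le> p (v + t *\<^sub>R y) - t * p y" for c v
    unfolding tilt_def using that by (intro cINF_greatest) auto
  show "sublin (tilt p y)"
    unfolding sublin_def
  proof (intro conjI allI impI)
    fix u v
    have step: "tilt p y (u + v) \<le> (p (u + s *\<^sub>R y) - s * p y) + (p (v + t *\<^sub>R y) - t * p y)"
      if "s \<ge> 0" "t \<ge> 0" for s t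
      using le[of "s + t" "u + v"] add[of "u + s *\<^sub>R y" "v + t *\<^sub>R y"] that
      by (simp add: algebra_simps)
    have "tilt p y (u + v) - (p (u + s *\<^sub>R y) - s * p y) \<le> tilt p y v" if "s \<ge> 0" for s
      by (rule ge) (use step[OF that] in \<open>simp add: algebra_simps\<close>)
    then have "tilt p y (u + v) - tilt p y v \<le> tilt p y u"
      by (intro ge) (simp add: algebra_simps)
    then show "tilt p y (u + v) \<le> tilt p y u + tilt p y v" by simp
  next
    fix r :: real and v assume r: "r > 0"
    have half: "tilt p y (r *\<^sub>R v) \<le> r * tilt p y v" if r: "r > 0" for r v
    proof -
      have "tilt p y (r *\<^sub>R v) / r \<le> tilt p y v"
      proof (rule ge)
        fix t :: real assume "t \<ge> 0"
        then have "tilt p y (r *\<^sub>R v) \<le> p (r *\<^sub>R v + (r * t) *\<^sub>R y) - (r * t) * p y"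
          using r by (intro le) auto
        also have "\<dots> = r * (p (v + t *\<^sub>R y) - t * p y)"
          using scale[of r "v + t *\<^sub>R y"] r by (simp add: algebra_simps)
        finally show "tilt p y (r *\<^sub>R v) / r \<le> p (v + t *\<^sub>R y) - t * p y"
          using r by (simp add: field_simps)
      qed
      then show ?thesis using r by (simp add: field_simps)
    qed
    have "tilt p y v \<le> inverse r * tilt p y (r *\<^sub>R v)"
      using half[of "inverse r" "r *\<^sub>R v"] r by simp
    then show "tilt p y (r *\<^sub>R v) = r * tilt p y v"
      using half[OF r, of v] r by (simp add: field_simps)
  qed
qed

text \<open>Instead of extending functionals from subspaces, Zorn's lemma yields a minimal sublinear
  functional below \<open>p\<close>, and minimality forces linearity. Subadditivity survives the
  infimum of a chain because, of two members, the smaller one can be used at both points.\<close>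

lemma sublin_minorant:
  fixes p :: "'a::real_vector \<Rightarrow> real"
  assumes p: "sublin p"
  shows "\<exists>f. linear f \<and> (\<forall>v. f v \<le> p v)"
proof -
  define A where "A = {q. sublin q \<and> (\<forall>v. q v \<le> p v)}"
  \<comment> \<open>The order is reversed, so that a maximal element in Zorn's lemma is minimal
    pointwise.\<close>
  let ?P = "\<lambda>q q'. \<forall>v::'a. q' v \<le> (q v :: real)"
  have "\<exists>m\<in>A. \<forall>q\<in>A. ?P m q \<longrightarrow> q = m"
  proof (rule predicate_Zorn)
    show "partial_order_on A (relation_of ?P A)"
    proof (intro partial_order_on_relation_ofI)
      show "a = b" if "?P a b" "?P b a" for a b
        using that by (intro ext antisym) auto
    qed (auto intro: order_trans)
  next
    fix C assume C: "C \<in> Chains (relation_of ?P A)"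
    show "\<exists>u\<in>A. \<forall>q\<in>C. ?P q u"
    proof (cases "C = {}")
      case True
      then show ?thesis using p by (auto simp: A_def)
    next
      case False
      have CA: "C \<subseteq> A"
        using C by (auto simp: Chains_def relation_of_def)
      have chain: "?P q r \<or> ?P r q" if "q \<in> C" "r \<in> C" for q r
        using C that by (auto simp: Chains_def relation_of_def)
      define u where "u v = (INF q\<in>C. q v)" for v
      have lower: "- p (- v) \<le> q v" if "q \<in> C" for q v
      proof -
        have "sublin q" "q (- v) \<le> p (- v)"
          using CA that by (auto simp: A_def)
        then show ?thesis
          using sublin_lower[of q v] by linarith
      qed
      then have bdd: "bdd_below ((\<lambda>q. q v) ` C)" for v
        by (intro bdd_belowI2[where m = "- p (- v)"]) auto
      have le: "u v \<le> q v" if "q \<in> C" for q v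
        unfolding u_def by (rule cINF_lower[OF bdd that])
      have ge: "c \<le> u v" if "\<And>q. q \<in> C \<Longrightarrow> c \<le> q v" for c v
        unfolding u_def using that False by (intro cINF_greatest) auto
      have sub: "sublin q" if "q \<in> C" for q
        using CA that by (auto simp: A_def)
      have "sublin u"
        unfolding sublin_def
      proof (intro conjI allI impI)
        fix a b
        have step: "u (a + b) \<le> q a + r b" if "q \<in> C" "r \<in> C" for q r
          using chain[OF that] le[OF that(1), of "a + b"] le[OF that(2), of "a + b"]
            sub[OF that(1)] sub[OF that(2)] unfolding sublin_def
          by (smt (verit))
        have "u (a + b) - q a \<le> u b" if "q \<in> C" for q
          by (rule ge) (use step[OF that] in \<open>simp add: algebra_simps\<close>)
        then have "u (a + b) - u b \<le> u a"
          by (intro ge) (simp add: algebra_simps)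
        then show "u (a + b) \<le> u a + u b" by simp
      next
        fix r :: real and v assume r: "r > 0"
        have "u (r *\<^sub>R v) / r \<le> u v"
        proof (rule ge)
          fix q assume "q \<in> C"
          then show "u (r *\<^sub>R v) / r \<le> q v"
            using le[of q "r *\<^sub>R v"] sub[of q] r by (simp add: sublin_def field_simps)
        qed
        moreover have "r * u v \<le> u (r *\<^sub>R v)"
        proof (rule ge)
          fix q assume "q \<in> C"
          then show "r * u v \<le> q (r *\<^sub>R v)"
            using le[of q v] sub[of q] r by (simp add: sublin_def)
        qed
        ultimately show "u (r *\<^sub>R v) = r * u v"
          using r by (simp add: field_simps)
      qed
      moreover have "u v \<le> p v" for v
      proof -
        obtain q where "q \<in> C" using False by blast
        then show ?thesis
          using CA le[of q v] order_trans[of "u v" "q v" "p v"] by (auto simp: A_def subset_iff)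
      qed
      ultimately show ?thesis
        using le by (auto simp: A_def)
    qed
  qed
  then obtain f where f: "f \<in> A" and min: "\<And>q. q \<in> A \<Longrightarrow> ?P f q \<Longrightarrow> q = f"
    by blast
  have sub: "sublin f" using f by (simp add: A_def)
  \<comment> \<open>Minimality identifies \<open>f\<close> with all its tilts, and \<open>tilt f y v \<le> f (v + y) - f y\<close> then gives
    superadditivity.\<close>
  have "tilt f y = f" for y
  proof (rule min)
    have "\<forall>v. tilt f y v \<le> f v"
      using tilt_le[OF sub, of 0] by simp
    then show "?P f (tilt f y)" "tilt f y \<in> A"
      using f sublin_tilt[OF sub] by (auto simp: A_def intro: order_trans)
  qed
  then have "f v + f y \<le> f (v + y)" for v y
    using tilt_le[OF sub, of 1 y v] by simp
  then have add: "f (v + y) = f v + f y" for v y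
    using sub by (auto simp: sublin_def intro: antisym)
  have neg: "f (- v) = - f v" for v
    using add[of v "- v"] sublin_zero[OF sub] by simp
  have "f (r *\<^sub>R v) = r * f v" for r v
  proof (cases r "0::real" rule: linorder_cases)
    case less
    then have "f ((- r) *\<^sub>R v) = (- r) * f v"
      using sub by (auto simp only: sublin_def neg_0_less_iff_less)
    then show ?thesis using neg[of "r *\<^sub>R v"] by simp
  qed (use sub sublin_zero[OF sub] in \<open>auto simp: sublin_def\<close>)
  then have "linear f"
    by (intro linearI) (auto simp: add)
  then show ?thesis
    using f by (auto simp: A_def)
qed

lemma norming_functional:
  fixes v :: "'a::real_normed_vector"
  shows "\<exists>f :: 'a \<Rightarrow>\<^sub>L real. norm f \<le> 1 \<and> blinfun_apply f v = norm v"
proof -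
  have n: "sublin (norm :: 'a \<Rightarrow> real)"
    by (auto simp: sublin_def norm_triangle_ineq)
  obtain f where lin: "linear f" and f: "\<And>u. f u \<le> tilt norm v u"
    using sublin_minorant[OF sublin_tilt[OF n]] by blast
  have le: "f u \<le> norm u" for u
    using f[of u] tilt_le[OF n, of 0 v u] by simp
  then have abs: "\<bar>f u\<bar> \<le> norm u" for u
    using le[of u] le[of "- u"] linear_neg[OF lin, of u] by (auto simp: abs_real_def)
  then have bl: "bounded_linear f"
    using lin by (intro bounded_linear_intro[where K = 1]) (auto simp: linear_add linear_scale)
  have "f (- v) \<le> - norm v"
    using f[of "- v"] tilt_le[OF n, of 1 v "- v"] by simp
  then have "f v = norm v"
    using le[of v] linear_neg[OF lin, of v] by simp
  moreover have "norm (Blinfun f) \<le> 1"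
    using abs bounded_linear_Blinfun_apply[OF bl] by (intro norm_blinfun_bound) auto
  ultimately show ?thesis
    using bounded_linear_Blinfun_apply[OF bl] by (intro exI[of _ "Blinfun f"]) auto
qed

text \<open>The argument of Banach-Alaoglu. If no finite \<open>Q\<close> works, linearity and the
  closed conditions \<open>D q\<close> have the finite intersection property in the product
  \<open>K\<close> of the intervals from \<open>- norm v\<close> to \<open>norm v\<close>, compact
  by Tychonoff. A common point is a functional in the dual ball of modulus at least
  \<open>\<delta>\<close> at every \<open>x q\<close> with \<open>q\<close> in \<open>P\<close>,
  against weak nullness.\<close>

lemma weakly_null_uniformly_small:
  fixes x :: "nat \<Rightarrow> 'a::real_normed_vector"
  assumes x: "weakly_null x" and "infinite P" "\<delta> > 0"
  shows "\<exists>Q\<subseteq>P. finite Q \<and> (\<forall>f :: 'a \<Rightarrow>\<^sub>L real. norm f \<le> 1 \<longrightarrow> (\<exists>q\<in>Q. \<bar>blinfun_apply f (x q)\<bar> \<le> \<delta>))"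
proof (rule ccontr)
  assume contr: "\<not> ?thesis"
  define K where "K = (\<Pi>\<^sub>E v\<in>UNIV. {- norm v..norm (v::'a)})"
  define Lin where "Lin = {h :: 'a \<Rightarrow> real. (\<forall>u v. h (u + v) = h u + h v) \<and> (\<forall>r v. h (r *\<^sub>R v) = r * h v)}"
  define D where "D q = {h :: 'a \<Rightarrow> real. \<delta> \<le> \<bar>h (x q)\<bar>}" for q
  have coord: "continuous_on UNIV (\<lambda>h :: 'a \<Rightarrow> real. h v)" for v
    by (rule continuous_on_product_coordinates)
  have "compact K"
    unfolding K_def using compactin_PiE[of "\<lambda>_. euclidean" UNIV "\<lambda>v::'a. {- norm v..norm v}"]
    by (simp add: euclidean_product_topology)
  have clLin: "closed Lin"
    unfolding Lin_def
    by (intro closed_Collect_conj closed_Collect_all closed_Collect_eq continuous_intros coord)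
  have clD: "closed (D q)" for q
    unfolding D_def by (intro closed_Collect_le continuous_intros coord)
  have "K \<inter> \<Inter> (insert Lin (D ` P)) \<noteq> {}"
  proof (rule compact_imp_fip[OF \<open>compact K\<close>])
    fix F assume F: "finite F" "F \<subseteq> insert Lin (D ` P)"
    then obtain Q where Q: "Q \<subseteq> P" "finite Q" "F - {Lin} = D ` Q"
      using finite_subset_image[of "F - {Lin}" D P] by auto
    then obtain f :: "'a \<Rightarrow>\<^sub>L real" where f: "norm f \<le> 1" "\<And>q. q \<in> Q \<Longrightarrow> \<delta> < \<bar>blinfun_apply f (x q)\<bar>"
      using contr by (meson not_le)
    have "\<bar>blinfun_apply f v\<bar> \<le> norm v" for v
      using norm_blinfun[of f v] mult_right_mono[OF f(1) norm_ge_zero[of v]] by simp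
    then have "blinfun_apply f \<in> K"
      by (auto simp: K_def abs_le_iff minus_le_iff)
    moreover have "blinfun_apply f \<in> Lin"
      by (auto simp: Lin_def blinfun.add_right blinfun.scaleR_right)
    moreover have "blinfun_apply f \<in> D q" if "q \<in> Q" for q
      using f(2)[OF that] by (simp add: D_def)
    ultimately have "blinfun_apply f \<in> K \<inter> \<Inter> F"
      using Q(3) by blast
    then show "K \<inter> \<Inter> F \<noteq> {}" by blast
  qed (use clLin clD in auto)
  then obtain g where g: "g \<in> K" "g \<in> Lin" "\<And>q. q \<in> P \<Longrightarrow> g \<in> D q"
    by blast
  have "\<bar>g v\<bar> \<le> norm v" for v
    using g(1) by (auto simp: K_def abs_le_iff PiE_iff minus_le_iff)
  then have "bounded_linear g"
    using g(2) by (intro bounded_linear_intro[where K = 1]) (auto simp: Lin_def)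
  then have "(\<lambda>n. g (x n)) \<longlonglongrightarrow> 0"
    using x by (auto simp: weakly_null_def)
  then have "\<forall>\<^sub>F n in sequentially. \<bar>g (x n)\<bar> < \<delta>"
    using \<open>\<delta> > 0\<close> by (auto dest!: tendstoD simp: dist_real_def)
  then obtain m where "\<And>n. n \<ge> m \<Longrightarrow> \<bar>g (x n)\<bar> < \<delta>"
    by (auto simp: eventually_sequentially)
  moreover obtain q where "q \<in> P" "q \<ge> m"
    using \<open>infinite P\<close> by (meson infinite_nat_iff_unbounded_le)
  ultimately show False
    using g(3)[of q] by (force simp: D_def)
qed

section \<open>Elton's theorem\<close>

definition nonneg_functionals :: "(nat \<Rightarrow> 'a::real_normed_vector) \<Rightarrow> real \<Rightarrow> nat set \<Rightarrow> ('a \<Rightarrow>\<^sub>L real) set" where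
  "nonneg_functionals x K G =
     {f. norm f \<le> 1 \<and> (\<forall>n\<in>G. blinfun_apply f (x n) \<ge> 0) \<and> (\<Sum>n\<in>G. blinfun_apply f (x n)) \<ge> K}"

lemma abs_blinfun_le:
  fixes f :: "'a::real_normed_vector \<Rightarrow>\<^sub>L real"
  assumes "norm f \<le> 1"
  shows "\<bar>blinfun_apply f v\<bar> \<le> norm v"
  using norm_blinfun[of f v] mult_right_mono[OF assms norm_ge_zero[of v]] by simp

text \<open>\<open>matching\<close> asks for a thin family, so it is applied to the sets that carry
  such a functional while no proper initial segment does. This is why \<open>G\<close> shrinks to an
  initial segment \<open>G'\<close>; the lower bound \<open>K\<close> on the sum survives.\<close>

lemma nonneg_functionals_matching:
  fixes x :: "nat \<Rightarrow> 'a::real_normed_vector"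
  assumes "weakly_null x" "infinite M"
  shows "\<exists>N\<subseteq>M. infinite N \<and> (\<forall>s. finite s \<and> s \<subseteq> N \<longrightarrow> (\<forall>G\<subseteq>s. nonneg_functionals x K G \<noteq> {} \<longrightarrow>
    (\<exists>G'\<subseteq>G. \<exists>f\<in>nonneg_functionals x K G'. (\<Sum>n\<in>s - G'. \<bar>blinfun_apply f (x n)\<bar>) \<le> 1)))"
proof -
  let ?V = "nonneg_functionals x K"
  define \<B> where "\<B> = {G. ?V G \<noteq> {} \<and> (\<forall>n. ?V (G \<inter> {..<n}) \<noteq> {} \<longrightarrow> G \<inter> {..<n} = G)}"
  define W where "W G = (\<lambda>f n. blinfun_apply f (x n)) ` ?V G" for G
  have "thin \<B>"
    unfolding thin_def initseg_def
  proof (intro ballI impI, elim exE)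
    fix s t n assume "s \<in> \<B>" "t \<in> \<B>" "s = t \<inter> {..<n}"
    then show "s = t"
      unfolding \<B>_def by blast
  qed
  moreover have "uniformly_small (\<Union>G\<in>\<B>. W G)"
    unfolding uniformly_small_def
  proof (intro allI impI)
    fix P :: "nat set" and \<delta> :: real assume P: "infinite P" "\<delta> > 0"
    obtain Q where Q: "Q \<subseteq> P" "finite Q"
      "\<forall>f :: 'a \<Rightarrow>\<^sub>L real. norm f \<le> 1 \<longrightarrow> (\<exists>q\<in>Q. \<bar>blinfun_apply f (x q)\<bar> \<le> \<delta>)"
      using weakly_null_uniformly_small[OF assms(1) P] by (elim exE conjE)
    have "\<exists>q\<in>Q. \<bar>w q\<bar> \<le> \<delta>" if "w \<in> W G" for w G
      using that Q(3) by (auto simp: W_def nonneg_functionals_def)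
    then show "\<exists>Q\<subseteq>P. finite Q \<and> (\<forall>w\<in>\<Union>G\<in>\<B>. W G. \<exists>q\<in>Q. \<bar>w q\<bar> \<le> \<delta>)"
      using Q(1,2) by blast
  qed
  moreover have "W G \<noteq> {}" if "G \<in> \<B>" for G
    using that by (simp add: \<B>_def W_def)
  ultimately obtain N where N: "N \<subseteq> M" "infinite N"
    and match: "\<And>G H. finite G \<Longrightarrow> finite H \<Longrightarrow> G \<subseteq> N \<Longrightarrow> H \<subseteq> N \<Longrightarrow> G \<inter> H = {} \<Longrightarrow> G \<in> \<B> \<Longrightarrow>
      \<exists>w\<in>W G. (\<Sum>h\<in>H. \<bar>w h\<bar>) \<le> 1"
    using matching[OF _ _ _ assms(2), of \<B> W] by metis
  have "\<exists>G'\<subseteq>G. \<exists>f\<in>?V G'. (\<Sum>n\<in>s - G'. \<bar>blinfun_apply f (x n)\<bar>) \<le> 1"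
    if s: "finite s" "s \<subseteq> N" "G \<subseteq> s" "?V G \<noteq> {}" for s G
  proof -
    have "finite G" using s finite_subset by blast
    then have "G \<inter> {..<Suc (Max (insert 0 G))} = G"
      by (auto simp: less_Suc_eq_le)
    then have ex: "\<exists>n. ?V (G \<inter> {..<n}) \<noteq> {}"
      using s(4) by metis
    define n where "n = (LEAST n. ?V (G \<inter> {..<n}) \<noteq> {})"
    have n: "?V (G \<inter> {..<n}) \<noteq> {}"
      unfolding n_def using ex by (rule LeastI_ex)
    have least: "n \<le> k" if "?V (G \<inter> {..<k}) \<noteq> {}" for k
      unfolding n_def using that by (rule Least_le)
    define G' where "G' = G \<inter> {..<n}"
    have "G' \<in> \<B>"
      unfolding \<B>_def
    proof (intro CollectI conjI allI impI)
      show "?V G' \<noteq> {}" using n by (simp add: G'_def)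
      fix k assume "?V (G' \<inter> {..<k}) \<noteq> {}"
      moreover have "G' \<inter> {..<k} = G \<inter> {..<min n k}"
        by (auto simp: G'_def)
      ultimately have "n \<le> k"
        using least[of "min n k"] by simp
      then show "G' \<inter> {..<k} = G'"
        by (auto simp: G'_def)
    qed
    moreover have "G' \<subseteq> G" "finite G'" "G' \<subseteq> N" "s - G' \<subseteq> N"
      using s \<open>finite G\<close> by (auto simp: G'_def)
    ultimately obtain w where "w \<in> W G'" "(\<Sum>h\<in>s - G'. \<bar>w h\<bar>) \<le> 1"
      using match[of G' "s - G'"] s(1) by blast
    then show ?thesis
      using \<open>G' \<subseteq> G\<close> by (auto simp: W_def)
  qed
  then show ?thesis
    using N by (intro exI[of _ N]) blast
qed

text \<open>Elton's near unconditionality: the coefficients of the projected part must stay above \<open>\<delta>\<close>.\<close>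

definition near_unconditional_on ::
  "(nat \<Rightarrow> 'a::real_normed_vector) \<Rightarrow> nat set \<Rightarrow> real \<Rightarrow> real \<Rightarrow> real \<Rightarrow> real \<Rightarrow> bool" where
  "near_unconditional_on x N \<delta> B R C \<longleftrightarrow>
    (\<forall>s b F. finite s \<and> s \<subseteq> N \<and> (\<forall>n\<in>s. \<bar>b n\<bar> \<le> B) \<and> norm (\<Sum>n\<in>s. b n *\<^sub>R x n) \<le> R \<and>
       F \<subseteq> s \<and> (\<forall>n\<in>F. \<delta> \<le> \<bar>b n\<bar>) \<longrightarrow> norm (\<Sum>n\<in>F. b n *\<^sub>R x n) \<le> C)"

lemma near_unconditional_on_subset:
  "near_unconditional_on x N \<delta> B R C \<Longrightarrow> N' \<subseteq> N \<Longrightarrow> near_unconditional_on x N' \<delta> B R C"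
  unfolding near_unconditional_on_def by (meson subset_trans)

text \<open>Suppose a norming functional of the projected sum were too large on the coordinates
  where it agrees in sign with \<open>b\<close>. Then some functional in the ball would have sum at
  least \<open>K\<close> on part of these coordinates and nearly vanish on all others in
  \<open>s\<close>; its value at the full sum would exceed \<open>R\<close>.\<close>

lemma elton_near_unconditional:
  fixes x :: "nat \<Rightarrow> 'a::real_normed_vector"
  assumes "weakly_null x" "infinite M" "\<delta> > 0" "B \<ge> 0"
  shows "\<exists>N\<subseteq>M. infinite N \<and> (\<exists>C. near_unconditional_on x N \<delta> B R C)"
proof -
  \<comment> \<open>Chosen so that \<open>\<delta> * K\<close> exceeds \<open>R + B\<close>. In
    \<open>pos_part\<close>, \<open>R\<close> bounds the value of the matched functional at the full
    sum and \<open>B\<close> its contribution off \<open>G'\<close>.\<close>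
  define K where "K = (\<bar>R\<bar> + B + 1) / \<delta>"
  obtain N where N: "N \<subseteq> M" "infinite N"
    and match: "\<And>s G. finite s \<Longrightarrow> s \<subseteq> N \<Longrightarrow> G \<subseteq> s \<Longrightarrow> nonneg_functionals x K G \<noteq> {} \<Longrightarrow>
    (\<exists>G'\<subseteq>G. \<exists>f\<in>nonneg_functionals x K G'. (\<Sum>n\<in>s - G'. \<bar>blinfun_apply f (x n)\<bar>) \<le> 1)"
    using nonneg_functionals_matching[OF assms(1,2), of K] by metis
  have pos_part: "(\<Sum>n\<in>G. blinfun_apply f (x n)) \<le> K"
    if s: "finite s" "s \<subseteq> N" "\<And>n. n \<in> s \<Longrightarrow> \<bar>b n\<bar> \<le> B" "norm (\<Sum>n\<in>s. b n *\<^sub>R x n) \<le> R"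
      and G: "G \<subseteq> s" "\<And>n. n \<in> G \<Longrightarrow> \<delta> \<le> b n"
      and f: "norm f \<le> 1" "\<And>n. n \<in> G \<Longrightarrow> 0 \<le> blinfun_apply f (x n)"
    for s b G and f :: "'a \<Rightarrow>\<^sub>L real"
  proof (rule ccontr)
    assume "\<not> ?thesis"
    then have "f \<in> nonneg_functionals x K G"
      using f by (auto simp: nonneg_functionals_def)
    then obtain G' g where G': "G' \<subseteq> G" and g: "g \<in> nonneg_functionals x K G'"
      and small: "(\<Sum>n\<in>s - G'. \<bar>blinfun_apply g (x n)\<bar>) \<le> 1"
      using match[OF s(1,2) G(1)] by blast
    have "finite G'" "G' \<subseteq> s" using G' G(1) finite_subset[OF _ s(1)] by auto
    have "\<delta> * K \<le> \<delta> * (\<Sum>n\<in>G'. blinfun_apply g (x n))"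
      using g assms(3) by (intro mult_left_mono) (auto simp: nonneg_functionals_def)
    also have "\<dots> \<le> (\<Sum>n\<in>G'. b n * blinfun_apply g (x n))"
      unfolding sum_distrib_left using g G G'
      by (intro sum_mono mult_right_mono) (auto simp: nonneg_functionals_def)
    also have "\<dots> = (\<Sum>n\<in>s. b n * blinfun_apply g (x n)) - (\<Sum>n\<in>s - G'. b n * blinfun_apply g (x n))"
      using \<open>G' \<subseteq> s\<close> s(1) by (simp add: sum_diff)
    also have "(\<Sum>n\<in>s. b n * blinfun_apply g (x n)) = blinfun_apply g (\<Sum>n\<in>s. b n *\<^sub>R x n)"
      by (simp add: blinfun.sum_right blinfun.scaleR_right)
    also have "\<dots> \<le> R"
      using abs_blinfun_le[of g "\<Sum>n\<in>s. b n *\<^sub>R x n"] g s(4) by (simp add: nonneg_functionals_def)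
    finally have "\<delta> * K \<le> R - (\<Sum>n\<in>s - G'. b n * blinfun_apply g (x n))" by simp
    moreover have "\<bar>\<Sum>n\<in>s - G'. b n * blinfun_apply g (x n)\<bar> \<le> (\<Sum>n\<in>s - G'. B * \<bar>blinfun_apply g (x n)\<bar>)"
      using s(3) by (intro order_trans[OF sum_abs] sum_mono) (auto simp: abs_mult intro!: mult_right_mono)
    moreover have "\<dots> \<le> B * 1"
      unfolding sum_distrib_left[symmetric] using small assms(4) by (intro mult_left_mono) auto
    ultimately have "\<delta> * K \<le> R + B" by linarith
    moreover have "\<delta> * K = \<bar>R\<bar> + B + 1"
      using assms(3) by (simp add: K_def)
    ultimately show False by linarith
  qed
  have "norm (\<Sum>n\<in>F. b n *\<^sub>R x n) \<le> 2 * B * K"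
    if s: "finite s" "s \<subseteq> N" "\<forall>n\<in>s. \<bar>b n\<bar> \<le> B" "norm (\<Sum>n\<in>s. b n *\<^sub>R x n) \<le> R"
      and F: "F \<subseteq> s" "\<forall>n\<in>F. \<delta> \<le> \<bar>b n\<bar>" for s b F
  proof -
    have "finite F" using F s finite_subset by blast
    obtain f :: "'a \<Rightarrow>\<^sub>L real" where f: "norm f \<le> 1"
      "blinfun_apply f (\<Sum>n\<in>F. b n *\<^sub>R x n) = norm (\<Sum>n\<in>F. b n *\<^sub>R x n)"
      using norming_functional by blast
    let ?c = "\<lambda>n. b n * blinfun_apply f (x n)"
    \<comment> \<open>Terms in which \<open>b n\<close> and the functional have opposite signs are
      at most 0 and are dropped. The remaining ones fall under \<open>pos_part\<close>, for
      \<open>b\<close> and \<open>f\<close> on \<open>G1\<close>, for \<open>- b\<close> and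
      \<open>- f\<close> on \<open>G2\<close>.\<close>
    define G1 where "G1 = {n \<in> F. b n > 0 \<and> blinfun_apply f (x n) \<ge> 0}"
    define G2 where "G2 = {n \<in> F. b n < 0 \<and> blinfun_apply f (x n) \<le> 0}"
    have 1: "(\<Sum>n\<in>G1. blinfun_apply f (x n)) \<le> K"
      using F by (intro pos_part[of s b]) (use s f in \<open>auto simp: G1_def\<close>)
    have 2: "(\<Sum>n\<in>G2. blinfun_apply (- f) (x n)) \<le> K"
      using F s f
      by (intro pos_part[of s "\<lambda>n. - b n"])
         (auto simp: G2_def sum_negf uminus_blinfun.rep_eq)
    have "norm (\<Sum>n\<in>F. b n *\<^sub>R x n) = (\<Sum>n\<in>F. ?c n)"
      using f(2) by (simp add: blinfun.sum_right blinfun.scaleR_right)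
    also have "\<dots> \<le> (\<Sum>n\<in>F. (if n \<in> G1 then B * blinfun_apply f (x n) else 0) +
        (if n \<in> G2 then B * blinfun_apply (- f) (x n) else 0))"
    proof (rule sum_mono)
      fix n assume "n \<in> F"
      then have bB: "\<bar>b n\<bar> \<le> B" using F s by auto
      show "?c n \<le> (if n \<in> G1 then B * blinfun_apply f (x n) else 0) +
        (if n \<in> G2 then B * blinfun_apply (- f) (x n) else 0)"
      proof (cases "b n > 0 \<and> blinfun_apply f (x n) \<ge> 0 \<or> b n < 0 \<and> blinfun_apply f (x n) \<le> 0")
        case True
        have "?c n \<le> \<bar>b n\<bar> * \<bar>blinfun_apply f (x n)\<bar>"
          by (metis abs_ge_self abs_mult)
        also have "\<dots> \<le> B * \<bar>blinfun_apply f (x n)\<bar>"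
          using bB by (intro mult_right_mono) auto
        finally show ?thesis
          using True \<open>n \<in> F\<close> by (auto simp: G1_def G2_def uminus_blinfun.rep_eq)
      next
        case False
        then have "?c n \<le> 0"
          by (cases "b n" "0::real" rule: linorder_cases) (auto simp: mult_le_0_iff)
        then show ?thesis
          using False by (auto simp: G1_def G2_def)
      qed
    qed
    also have "\<dots> = B * (\<Sum>n\<in>G1. blinfun_apply f (x n)) + B * (\<Sum>n\<in>G2. blinfun_apply (- f) (x n))"
    proof -
      have "F \<inter> G1 = G1" "F \<inter> G2 = G2" by (auto simp: G1_def G2_def)
      then show ?thesis
        using \<open>finite F\<close> by (simp add: sum.distrib sum_distrib_left flip: sum.inter_restrict)
    qed
    also have "\<dots> \<le> B * K + B * K"
      using 1 2 assms(4) by (intro add_mono mult_left_mono) auto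
    finally show ?thesis by simp
  qed
  then show ?thesis
    using N unfolding near_unconditional_on_def by (intro exI[of _ N]) blast
qed

lemma near_unconditional_subsequence:
  fixes x :: "nat \<Rightarrow> 'a::real_normed_vector"
  assumes x: "weakly_null x" "\<And>n. norm (x n) \<le> 1" and "infinite M"
  shows "\<exists>N\<subseteq>M. infinite N \<and> (\<forall>\<delta> B R. \<delta> > 0 \<longrightarrow> (\<exists>C. near_unconditional_on x N \<delta> B R C))"
proof -
  \<comment> \<open>Diagonalisation: beyond its first \<open>k\<close> elements, \<open>N\<close> has Elton's property for parameters of order
    \<open>k\<close>, with enough slack in \<open>R\<close> to cut off those \<open>k\<close> terms.\<close>
  let ?Q = "\<lambda>s N. \<exists>C. near_unconditional_on x N (1 / Suc (card s)) (Suc (card s)) (real (Suc (card s)) + (Suc (card s))\<^sup>2) C"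
  have "\<exists>N\<subseteq>M. infinite N \<and> (\<forall>s\<subseteq>N. finite s \<longrightarrow> ?Q s (above s N))"
  proof (rule fusion[OF _ _ assms(3)])
    show "?Q s N'" if "?Q s N" "N' \<subseteq> N" for s N N'
      using that near_unconditional_on_subset by blast
    show "\<exists>N'\<subseteq>N. infinite N' \<and> ?Q s N'" if "infinite N" for s N
      by (rule elton_near_unconditional[OF x(1) that]) auto
  qed
  then obtain N where N: "N \<subseteq> M" "infinite N"
    and Q: "\<And>s. s \<subseteq> N \<Longrightarrow> finite s \<Longrightarrow> ?Q s (above s N)"
    by (elim exE conjE) simp
  have "\<exists>C. near_unconditional_on x N \<delta> B R C" if \<delta>: "\<delta> > 0" for \<delta> B R
  proof -
    obtain k :: nat where k: "1 / \<delta> < k" "B \<le> k" "R \<le> k"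
      using reals_Archimedean2[of "max (1 / \<delta>) (max B R)"] by auto
    obtain s where s: "s \<subseteq> N" "finite s" "card s = k"
      using infinite_arbitrarily_large[OF N(2)] by blast
    \<comment> \<open>Enlarging \<open>s\<close> to a full initial segment of \<open>N\<close>
      ensures that \<open>N\<close> consists of \<open>s'\<close> and \<open>above s' N\<close>
      only. The parameters are then taken for \<open>k'\<close>, which is at least
      \<open>k\<close>.\<close>
    define s' where "s' = {n \<in> N. n \<le> Max (insert 0 s)}"
    define k' where "k' = card s'"
    have s': "s' \<subseteq> N" "finite s'"
      by (auto simp: s'_def)
    have "s \<subseteq> s'"
      using s by (auto simp: s'_def)
    then have "k \<le> k'"
      using s(3) s'(2) card_mono by (auto simp: k'_def)
    have split: "n \<in> s' \<or> n \<in> above s' N" if "n \<in> N" for n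
      using that by (auto simp: s'_def above_def)
    obtain C where C: "near_unconditional_on x (above s' N) (1 / Suc k') (Suc k') (real (Suc k') + (Suc k')\<^sup>2) C"
      using Q[OF s'] by (auto simp: k'_def)
    have "1 / \<delta> \<le> Suc k'"
      using k(1) \<open>k \<le> k'\<close> by linarith
    then have \<delta>k: "1 / Suc k' \<le> \<delta>"
      using \<delta> by (simp add: field_simps)
    have B: "B \<le> Suc k'" and R: "R \<le> Suc k'"
      using k \<open>k \<le> k'\<close> by linarith+
    have head: "norm (\<Sum>n\<in>t \<inter> s'. b n *\<^sub>R x n) \<le> (Suc k')\<^sup>2"
      if b: "\<And>n. n \<in> t \<Longrightarrow> \<bar>b n\<bar> \<le> B" for t and b :: "nat \<Rightarrow> real"
    proof -
      have "norm (\<Sum>n\<in>t \<inter> s'. b n *\<^sub>R x n) \<le> (\<Sum>n\<in>t \<inter> s'. real (Suc k'))"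
      proof (intro order_trans[OF norm_sum] sum_mono)
        fix n assume "n \<in> t \<inter> s'"
        then have "\<bar>b n\<bar> * norm (x n) \<le> real (Suc k') * 1"
          using b[of n] B x(2)[of n] by (intro mult_mono) auto
        then show "norm (b n *\<^sub>R x n) \<le> real (Suc k')" by simp
      qed
      also have "\<dots> \<le> real (Suc k') * real (Suc k')"
        using card_mono[of s' "t \<inter> s'"] s'(2) by (auto simp: k'_def intro!: mult_right_mono)
      finally show ?thesis by (simp only: power2_eq_square of_nat_mult)
    qed
    have decomp: "(\<Sum>n\<in>t. b n *\<^sub>R x n) = (\<Sum>n\<in>t \<inter> s'. b n *\<^sub>R x n) + (\<Sum>n\<in>t - s'. b n *\<^sub>R x n)"
      if "finite t" for t and b :: "nat \<Rightarrow> real"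
      using sum.Int_Diff[OF that] .
    have "near_unconditional_on x N \<delta> B R ((Suc k')\<^sup>2 + C)"
      unfolding near_unconditional_on_def
    proof (intro allI impI, elim conjE)
      fix t b F
      assume t: "finite t" "t \<subseteq> N" "\<forall>n\<in>t. \<bar>b n\<bar> \<le> B" "norm (\<Sum>n\<in>t. b n *\<^sub>R x n) \<le> R"
        and F: "F \<subseteq> t" "\<forall>n\<in>F. \<delta> \<le> \<bar>b n\<bar>"
      have "finite F" using F t finite_subset by blast
      have "norm (\<Sum>n\<in>t - s'. b n *\<^sub>R x n) \<le> norm (\<Sum>n\<in>t. b n *\<^sub>R x n) + norm (\<Sum>n\<in>t \<inter> s'. b n *\<^sub>R x n)"
        using decomp[OF t(1), of b] norm_triangle_ineq4[of "\<Sum>n\<in>t. b n *\<^sub>R x n" "\<Sum>n\<in>t \<inter> s'. b n *\<^sub>R x n"]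
        by simp
      also have "\<dots> \<le> real (Suc k') + (Suc k')\<^sup>2"
        using head[of t b] t(3,4) R by (intro add_mono) auto
      finally have tail: "norm (\<Sum>n\<in>t - s'. b n *\<^sub>R x n) \<le> real (Suc k') + (Suc k')\<^sup>2" .
      have "t - s' \<subseteq> above s' N"
        using t(2) split by blast
      moreover have "\<forall>n\<in>t - s'. \<bar>b n\<bar> \<le> Suc k'" "\<forall>n\<in>F - s'. 1 / Suc k' \<le> \<bar>b n\<bar>"
        using t(3) B F(2) \<delta>k by (auto intro: order_trans)
      ultimately have "norm (\<Sum>n\<in>F - s'. b n *\<^sub>R x n) \<le> C"
        using C[unfolded near_unconditional_on_def, rule_format, of "t - s'" b "F - s'"] tail F(1) t(1)
        by auto
      moreover have "norm (\<Sum>n\<in>F \<inter> s'. b n *\<^sub>R x n) \<le> (Suc k')\<^sup>2"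
        using F t by (intro head) auto
      ultimately show "norm (\<Sum>n\<in>F. b n *\<^sub>R x n) \<le> (Suc k')\<^sup>2 + C"
        unfolding decomp[OF \<open>finite F\<close>, of b] by (intro order_trans[OF norm_triangle_ineq] add_mono)
    qed
    then show ?thesis by blast
  qed
  then show ?thesis using N by blast
qed

section \<open>Near diagonality and interpolation\<close>

text \<open>A fusion bounds by \<open>e\<close> the total \<open>D H\<close> of the off-diagonal
  entries over every finite \<open>H\<close>, hence also each row. For the second claim
  \<open>H0\<close> is chosen with \<open>D H0\<close> within \<open>\<eta>\<close> of the supremum:
  a row outside \<open>H0\<close> adds its whole sum to \<open>D H0\<close>, so that sum is at most
  \<open>\<eta>\<close>.\<close>

lemma small_off_diagonal:
  fixes a :: "nat \<Rightarrow> nat \<Rightarrow> real"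
  assumes nonneg: "\<And>p n. a p n \<ge> 0"
    and rows: "\<And>p. (\<lambda>n. a p n) \<longlonglongrightarrow> 0" and cols: "\<And>p. (\<lambda>n. a n p) \<longlonglongrightarrow> 0"
    and "e > 0" "infinite M"
  shows "\<exists>N\<subseteq>M. infinite N \<and> (\<forall>m\<in>N. \<forall>H\<subseteq>N. finite H \<longrightarrow> (\<Sum>n\<in>H - {m}. a m n) \<le> e) \<and>
    (\<forall>\<eta>>0. \<exists>H0. finite H0 \<and> (\<forall>m\<in>N - H0. \<forall>H\<subseteq>N. finite H \<longrightarrow> (\<Sum>n\<in>H - {m}. a m n) \<le> \<eta>))"
proof -
  \<comment> \<open>The row and the column that a new point \<open>n\<close> adds to
    \<open>s\<close> together cost at most a term of a geometric series with sum
    \<open>e\<close>.\<close>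
  let ?Q = "\<lambda>s N. \<forall>n\<in>N. (\<Sum>p\<in>s. a p n + a n p) \<le> e * (1/2) ^ Suc (card s)"
  have "\<exists>N\<subseteq>M. infinite N \<and> (\<forall>s\<subseteq>N. finite s \<longrightarrow> ?Q s (above s N))"
  proof (rule fusion[OF _ _ assms(5)])
    show "?Q s N'" if "?Q s N" "N' \<subseteq> N" for s N N'
      using that by blast
    fix s N :: "nat set" assume "infinite N"
    have "(\<lambda>n. \<Sum>p\<in>s. a p n + a n p) \<longlonglongrightarrow> (\<Sum>p\<in>s. 0 + 0)"
      by (intro tendsto_intros rows cols)
    then have "\<forall>\<^sub>F n in sequentially. (\<Sum>p\<in>s. a p n + a n p) < e * (1/2) ^ Suc (card s)"
      using assms(4) by (intro order_tendstoD) auto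
    then obtain k where k: "\<And>n. n \<ge> k \<Longrightarrow> (\<Sum>p\<in>s. a p n + a n p) < e * (1/2) ^ Suc (card s)"
      unfolding eventually_sequentially by blast
    have "infinite (N - {..<k})" using \<open>infinite N\<close> by simp
    moreover have "?Q s (N - {..<k})"
      using k by (auto intro: less_imp_le)
    ultimately show "\<exists>N'\<subseteq>N. infinite N' \<and> ?Q s N'"
      by (intro exI[of _ "N - {..<k}"]) blast
  qed
  then obtain N where N: "N \<subseteq> M" "infinite N"
    and Q: "\<And>s n. s \<subseteq> N \<Longrightarrow> finite s \<Longrightarrow> n \<in> above s N \<Longrightarrow> (\<Sum>p\<in>s. a p n + a n p) \<le> e * (1/2) ^ Suc (card s)"
    by (elim exE conjE) simp
  define D where "D H = (\<Sum>p\<in>H. \<Sum>n\<in>H - {p}. a p n)" for H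
  have D_le: "D H \<le> e * (1 - (1/2) ^ card H)" if "finite H" "H \<subseteq> N" for H
    using that
  proof (induction H rule: finite_linorder_max_induct)
    case empty
    then show ?case by (simp add: D_def)
  next
    case (insert n H)
    then have "n \<notin> H" "n \<in> above H N" by (auto simp: above_def)
    have "(\<Sum>k\<in>insert n H - {p}. a p k) = a p n + (\<Sum>k\<in>H - {p}. a p k)" if "p \<in> H" for p
    proof -
      have "insert n H - {p} = insert n (H - {p})" using that \<open>n \<notin> H\<close> by auto
      then show ?thesis using insert.hyps(1) \<open>n \<notin> H\<close> by simp
    qed
    then have "D (insert n H) = (\<Sum>p\<in>H. a n p) + (\<Sum>p\<in>H. a p n + (\<Sum>k\<in>H - {p}. a p k))"
      using insert.hyps(1) \<open>n \<notin> H\<close> by (simp add: D_def cong: sum.cong)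
    also have "\<dots> = D H + (\<Sum>p\<in>H. a p n + a n p)"
      by (simp add: D_def sum.distrib)
    also have "\<dots> \<le> e * (1 - (1/2) ^ card H) + e * (1/2) ^ Suc (card H)"
      using insert Q[of H n] \<open>n \<in> above H N\<close> by (intro add_mono) auto
    also have "\<dots> = e * (1 - (1/2) ^ card (insert n H))"
      using insert.hyps(1) \<open>n \<notin> H\<close> by (simp add: algebra_simps)
    finally show ?case .
  qed
  have D_bound: "D H \<le> e" if "finite H" "H \<subseteq> N" for H
  proof -
    have "e * (1 - (1/2) ^ card H) \<le> e * 1"
      using assms(4) by (intro mult_left_mono) auto
    then show ?thesis using D_le[OF that] by simp
  qed
  have D_row: "D H0 + (\<Sum>n\<in>H - {m}. a m n) \<le> D (insert m (H0 \<union> H))"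
    if "finite H0" "finite H" "m \<notin> H0" for H0 H m
  proof -
    let ?U = "insert m (H0 \<union> H)"
    have "D H0 + (\<Sum>n\<in>H - {m}. a m n) \<le> (\<Sum>p\<in>H0. \<Sum>n\<in>?U - {p}. a p n) + (\<Sum>n\<in>?U - {m}. a m n)"
      unfolding D_def using that nonneg
      by (intro add_mono sum_mono sum_mono2) auto
    also have "\<dots> = (\<Sum>p\<in>insert m H0. \<Sum>n\<in>?U - {p}. a p n)"
      using that by simp
    also have "\<dots> \<le> D ?U"
      unfolding D_def using that nonneg by (intro sum_mono2 sum_nonneg) auto
    finally show ?thesis .
  qed
  have "(\<Sum>n\<in>H - {m}. a m n) \<le> e" if "m \<in> N" "H \<subseteq> N" "finite H" for m H
    using D_row[of "{}" H m] D_bound[of "insert m H"] that by (simp add: D_def)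
  moreover have "\<exists>H0. finite H0 \<and> (\<forall>m\<in>N - H0. \<forall>H\<subseteq>N. finite H \<longrightarrow> (\<Sum>n\<in>H - {m}. a m n) \<le> \<eta>)"
    if "\<eta> > 0" for \<eta>
  proof -
    let ?S = "{H. finite H \<and> H \<subseteq> N}"
    have bdd: "bdd_above (D ` ?S)"
      using D_bound by (intro bdd_aboveI2[where M = e]) auto
    have "(SUP H\<in>?S. D H) - \<eta> < (SUP H\<in>?S. D H)" using that by simp
    moreover have "?S \<noteq> {}" by blast
    ultimately obtain H0 where H0: "finite H0" "H0 \<subseteq> N" "(SUP H\<in>?S. D H) - \<eta> < D H0"
      using less_cSUP_iff[OF _ bdd] by blast
    have "(\<Sum>n\<in>H - {m}. a m n) \<le> \<eta>" if m: "m \<in> N - H0" and H: "H \<subseteq> N" "finite H" for m H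
    proof -
      have "insert m (H0 \<union> H) \<in> ?S"
        using m H H0 by auto
      then have "D (insert m (H0 \<union> H)) \<le> (SUP H\<in>?S. D H)"
        using bdd by (rule cSUP_upper)
      then show ?thesis
        using D_row[of H0 H m] m H H0 by simp
    qed
    then show ?thesis using H0(1) by blast
  qed
  ultimately show ?thesis
    using N by (intro exI[of _ N]) simp
qed

section \<open>Restricted norms and interpolation in the unit ball of a subspace\<close>

lemma restr_norm_ge:
  assumes "z \<in> V" "norm z \<le> 1"
  shows "\<bar>blinfun_apply f z\<bar> \<le> restr_norm V f"
  unfolding restr_norm_def
proof (rule cSUP_upper)
  show "bdd_above ((\<lambda>z. \<bar>blinfun_apply f z\<bar>) ` {z \<in> V. norm z \<le> 1})"
  proof (rule bdd_aboveI2)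
    fix z assume "z \<in> {z \<in> V. norm z \<le> 1}"
    then have "norm f * norm z \<le> norm f * 1"
      by (intro mult_left_mono) auto
    then show "\<bar>blinfun_apply f z\<bar> \<le> norm f"
      using norm_blinfun[of f z] by simp
  qed
qed (use assms in simp)

lemma restr_norm_le:
  assumes "0 \<in> V" "\<And>z. z \<in> V \<Longrightarrow> norm z \<le> 1 \<Longrightarrow> \<bar>blinfun_apply f z\<bar> \<le> c"
  shows "restr_norm V f \<le> c"
  unfolding restr_norm_def using assms by (intro cSUP_least) (auto intro!: exI[of _ 0])

text \<open>A near-minimiser of the sum of squared errors over the unit ball is tested against
  its own error vector \<^term>\<open>r\<close>; this replaces a separation argument in a space of dimension
  \<^term>\<open>card F\<close>.\<close>

lemma approximate_interpolation:
  fixes f :: "nat \<Rightarrow> 'a::real_normed_vector \<Rightarrow>\<^sub>L real"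
  assumes V: "subspace V" and "finite F" "c > 0" "\<rho> > 0"
    and ell1: "\<And>r. c * (\<Sum>i\<in>F. \<bar>r i\<bar>) \<le> restr_norm V (\<Sum>i\<in>F. r i *\<^sub>R f i)"
    and t: "\<And>i. i \<in> F \<Longrightarrow> \<bar>t i\<bar> \<le> 1"
  shows "\<exists>z\<in>V. norm z \<le> 1 \<and> (\<forall>i\<in>F. \<bar>blinfun_apply (f i) z - c * t i\<bar> \<le> \<rho>)"
proof -
  define A where "A = {z \<in> V. norm z \<le> 1}"
  define \<phi> where "\<phi> z = (\<Sum>i\<in>F. (c * t i - blinfun_apply (f i) z)\<^sup>2)" for z
  have "0 \<in> A"
    using V by (simp add: A_def subspace_0)
  have "\<exists>z\<in>A. \<phi> z \<le> \<rho>\<^sup>2"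
  proof (rule ccontr)
    assume "\<not> ?thesis"
    then have big: "\<rho>\<^sup>2 < \<phi> z" if "z \<in> A" for z
      using that by force
    define Q where "Q = (\<Sum>i\<in>F. (2 * norm (f i))\<^sup>2)"
    \<comment> \<open>Step length from \<open>z\<close> towards another point of the ball. The
      second-order term, at most \<open>Q\<close> times the square of \<open>l\<close>, and the
      slack of near-minimality, again the square of \<open>l\<close>, add up to at most
      \<open>l\<close> times the square of \<open>\<rho>\<close>.\<close>
    define l where "l = min 1 (\<rho>\<^sup>2 / (1 + Q))"
    have "Q \<ge> 0" by (simp add: Q_def sum_nonneg)
    then have "l * (1 + Q) \<le> \<rho>\<^sup>2 / (1 + Q) * (1 + Q)"
      unfolding l_def by (intro mult_right_mono) auto
    then have l: "0 < l" "l \<le> 1" "l * (1 + Q) \<le> \<rho>\<^sup>2"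
      using assms(4) \<open>Q \<ge> 0\<close> by (auto simp: l_def)
    define d where "d = (INF z\<in>A. \<phi> z)"
    have bdd: "bdd_below (\<phi> ` A)"
      using big by (intro bdd_belowI2[where m = "\<rho>\<^sup>2"]) (auto intro: less_imp_le)
    have d_le: "d \<le> \<phi> z" if "z \<in> A" for z
      unfolding d_def using bdd that by (rule cINF_lower)
    have "d < d + l\<^sup>2" using l by simp
    then obtain z where z: "z \<in> A" "\<phi> z < d + l\<^sup>2"
      unfolding d_def using cINF_less_iff[OF _ bdd] \<open>0 \<in> A\<close> by blast
    define r where "r i = c * t i - blinfun_apply (f i) z" for i
    \<comment> \<open>First-order condition at a near-minimiser: no move towards a point
      \<open>u\<close> of the ball can lower the squared error by much.\<close>
    have test: "(\<Sum>i\<in>F. r i * blinfun_apply (f i) u) \<le> (\<Sum>i\<in>F. r i * blinfun_apply (f i) z) + \<rho>\<^sup>2 / 2"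
      if u: "u \<in> A" for u
    proof -
      define w where "w = z + l *\<^sub>R (u - z)"
      have "w = (1 - l) *\<^sub>R z + l *\<^sub>R u"
        by (simp add: w_def algebra_simps)
      moreover have "norm ((1 - l) *\<^sub>R z + l *\<^sub>R u) \<le> (1 - l) * 1 + l * 1"
        using z u l by (intro norm_triangle_le add_mono) (auto simp: A_def mult_left_le)
      ultimately have "w \<in> A"
        using z u V by (auto simp: A_def subspace_add subspace_scale)
      define v where "v i = blinfun_apply (f i) (u - z)" for i
      have "(v i)\<^sup>2 \<le> (2 * norm (f i))\<^sup>2" for i
      proof -
        have "\<bar>v i\<bar> \<le> norm (f i) * norm (u - z)"
          using norm_blinfun[of "f i" "u - z"] by (simp add: v_def)
        also have "\<dots> \<le> norm (f i) * 2"
          using norm_triangle_ineq4[of u z] u z by (intro mult_left_mono) (auto simp: A_def)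
        finally show ?thesis
          by (intro abs_le_square_iff[THEN iffD1]) simp
      qed
      then have vQ: "(\<Sum>i\<in>F. (v i)\<^sup>2) \<le> Q"
        unfolding Q_def by (intro sum_mono)
      have "\<phi> w = (\<Sum>i\<in>F. (r i - l * v i)\<^sup>2)"
        by (simp add: \<phi>_def r_def v_def w_def blinfun.add_right blinfun.scaleR_right diff_diff_eq)
      also have "\<dots> = \<phi> z - 2 * l * (\<Sum>i\<in>F. r i * v i) + l\<^sup>2 * (\<Sum>i\<in>F. (v i)\<^sup>2)"
        by (simp add: \<phi>_def r_def[symmetric] power2_diff sum.distrib sum_subtractf sum_distrib_left power_mult_distrib mult_ac)
      finally have "d \<le> \<phi> z - 2 * l * (\<Sum>i\<in>F. r i * v i) + l\<^sup>2 * Q"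
        using d_le[OF \<open>w \<in> A\<close>] mult_left_mono[OF vQ zero_le_power2[of l]] by linarith
      then have "2 * l * (\<Sum>i\<in>F. r i * v i) \<le> l * (l * (1 + Q))"
        using z(2) by (simp add: power2_eq_square algebra_simps)
      also have "\<dots> \<le> l * \<rho>\<^sup>2"
        using l by (intro mult_left_mono) auto
      finally have "(\<Sum>i\<in>F. r i * v i) \<le> \<rho>\<^sup>2 / 2"
        using l(1) by (simp add: field_simps)
      then show ?thesis
        by (simp add: v_def blinfun.diff_right right_diff_distrib sum_subtractf)
    qed
    have "restr_norm V (\<Sum>i\<in>F. r i *\<^sub>R f i) \<le> (\<Sum>i\<in>F. r i * blinfun_apply (f i) z) + \<rho>\<^sup>2 / 2"
    proof (rule restr_norm_le)
      show "0 \<in> V" using V by (rule subspace_0)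
      fix u assume "u \<in> V" "norm u \<le> 1"
      then have "u \<in> A" "- u \<in> A"
        using V by (auto simp: A_def subspace_neg)
      then show "\<bar>blinfun_apply (\<Sum>i\<in>F. r i *\<^sub>R f i) u\<bar> \<le> (\<Sum>i\<in>F. r i * blinfun_apply (f i) z) + \<rho>\<^sup>2 / 2"
        using test[of u] test[of "- u"]
        by (auto simp: abs_le_iff blinfun.sum_left blinfun.scaleR_left blinfun.minus_right sum_negf)
    qed
    \<comment> \<open>Since \<open>f i\<close> at \<open>z\<close> is \<open>c * t i - r i\<close>,
      the right side is at most \<open>c\<close> times the sum of the \<open>|r i|\<close>, minus
      \<open>\<phi> z\<close>, plus the small term. The two sums cancel and \<open>\<phi> z\<close>
      is below its supposed lower bound.\<close>
    then have "c * (\<Sum>i\<in>F. \<bar>r i\<bar>) \<le> (\<Sum>i\<in>F. r i * blinfun_apply (f i) z) + \<rho>\<^sup>2 / 2"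
      using ell1[of r] by linarith
    also have "(\<Sum>i\<in>F. r i * blinfun_apply (f i) z) = (\<Sum>i\<in>F. c * (t i * r i)) - \<phi> z"
      by (simp add: \<phi>_def r_def power2_eq_square algebra_simps flip: sum_subtractf)
    also have "(\<Sum>i\<in>F. c * (t i * r i)) \<le> (\<Sum>i\<in>F. c * \<bar>r i\<bar>)"
    proof (intro sum_mono mult_left_mono)
      fix i assume "i \<in> F"
      have "t i * r i \<le> \<bar>t i\<bar> * \<bar>r i\<bar>"
        by (metis abs_ge_self abs_mult)
      also have "\<dots> \<le> 1 * \<bar>r i\<bar>"
        using t[OF \<open>i \<in> F\<close>] by (intro mult_right_mono) auto
      finally show "t i * r i \<le> \<bar>r i\<bar>" by simp
    qed (use assms(3) in simp)
    finally have "\<phi> z \<le> \<rho>\<^sup>2 / 2"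
      by (simp add: sum_distrib_left)
    moreover have "\<rho>\<^sup>2 > 0" using assms(4) by simp
    ultimately show False
      using big[OF z(1)] by linarith
  qed
  then obtain z where z: "z \<in> A" "\<phi> z \<le> \<rho>\<^sup>2" by blast
  have "\<bar>blinfun_apply (f i) z - c * t i\<bar> \<le> \<rho>" if "i \<in> F" for i
  proof -
    have "(c * t i - blinfun_apply (f i) z)\<^sup>2 \<le> \<phi> z"
      unfolding \<phi>_def using that assms(2) by (intro member_le_sum) auto
    then have "(c * t i - blinfun_apply (f i) z)\<^sup>2 \<le> \<rho>\<^sup>2"
      using z(2) by linarith
    then have "\<bar>c * t i - blinfun_apply (f i) z\<bar> \<le> \<bar>\<rho>\<bar>"
      by (simp only: abs_le_square_iff)
    then show ?thesis
      using assms(4) by linarith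
  qed
  then show ?thesis
    using z(1) by (auto simp: A_def)
qed

text \<open>\<open>x\<close> may repeat values, so the vectors of the combination are first traced
  back to indices on which \<open>x\<close> is injective.\<close>

lemma span_image_sum:
  assumes "z \<in> span (x ` N)"
  shows "\<exists>s b. finite s \<and> s \<subseteq> N \<and> z = (\<Sum>n\<in>s. b n *\<^sub>R x n)"
proof -
  obtain T r where T: "finite T" "T \<subseteq> x ` N" "z = (\<Sum>v\<in>T. r v *\<^sub>R v)"
    using assms unfolding span_explicit by (elim CollectE exE conjE)
  then obtain s where "s \<subseteq> N" "inj_on x s" "T = x ` s"
    using T(2)[unfolded subset_image_inj] by (elim exE conjE)
  then show ?thesis
    using T by (intro exI[of _ s] exI[of _ "\<lambda>n. r (x n)"]) (auto simp: sum.reindex finite_image_iff)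
qed

section \<open>Duality of the two estimates\<close>

lemma subspace_closed_span_on: "subspace (closed_span_on x M)"
  unfolding closed_span_on_def
proof (rule subspaceI)
  show "0 \<in> closure (span (x ` M))"
    using closure_subset span_zero by blast
next
  fix u v assume "u \<in> closure (span (x ` M))" "v \<in> closure (span (x ` M))"
  then obtain f g where "\<And>n. f n \<in> span (x ` M)" "f \<longlonglongrightarrow> u" "\<And>n. g n \<in> span (x ` M)" "g \<longlonglongrightarrow> v"
    unfolding closure_sequential by blast
  then show "u + v \<in> closure (span (x ` M))"
    unfolding closure_sequential
    by (intro exI[of _ "\<lambda>n. f n + g n"] conjI allI span_add tendsto_add)
next
  fix r :: real and u assume "u \<in> closure (span (x ` M))"
  then obtain f where "\<And>n. f n \<in> span (x ` M)" "f \<longlonglongrightarrow> u"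
    unfolding closure_sequential by blast
  then show "r *\<^sub>R u \<in> closure (span (x ` M))"
    unfolding closure_sequential
    by (intro exI[of _ "\<lambda>n. r *\<^sub>R f n"] conjI allI span_scale tendsto_scaleR tendsto_const)
qed

lemma in_closed_span_on: "n \<in> M \<Longrightarrow> x n \<in> closed_span_on x M"
  unfolding closed_span_on_def by (intro closure_subset[THEN subsetD] span_base) auto

text \<open>It suffices to bound the sum of \<open>|g (x n)|\<close> over \<open>A\<close> uniformly
  in \<open>A\<close> and in \<open>g\<close> of norm at most 1. The bound \<open>rows\<close>
  controls the coefficients of the interpolating vector, but keeping their signs and size
  \<open>c / 2\<close> requires a smaller off-diagonal error. That error is available outside the
  finite set \<open>H0\<close>, on which each term is at most 1.\<close>

lemma c0_estimate_from_ell1: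
  fixes x :: "nat \<Rightarrow> 'a::real_normed_vector" and xs :: "nat \<Rightarrow> ('a \<Rightarrow>\<^sub>L real)"
  assumes norm_x: "\<And>n. norm (x n) = 1" and norm_xs: "\<And>n. norm (xs n) = 1"
    and "\<epsilon> > 0" and diag: "\<And>n. \<epsilon> \<le> \<bar>blinfun_apply (xs n) (x n)\<bar>"
    and rows: "\<And>m H. m \<in> N \<Longrightarrow> H \<subseteq> N \<Longrightarrow> finite H \<Longrightarrow> (\<Sum>n\<in>H - {m}. \<bar>blinfun_apply (xs m) (x n)\<bar>) \<le> \<epsilon> / 2"
    and tails: "\<And>\<eta>. \<eta> > 0 \<Longrightarrow> \<exists>H0. finite H0 \<and>
      (\<forall>m\<in>N - H0. \<forall>H\<subseteq>N. finite H \<longrightarrow> (\<Sum>n\<in>H - {m}. \<bar>blinfun_apply (xs m) (x n)\<bar>) \<le> \<eta>)"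
    and uncond: "\<And>\<delta> B R. \<delta> > 0 \<Longrightarrow> \<exists>C. near_unconditional_on x N \<delta> B R C"
    and "c > 0"
    and fin: "\<And>A. A \<in> \<A> \<Longrightarrow> finite A \<and> A \<subseteq> N"
    and ell1: "\<And>A r. A \<in> \<A> \<Longrightarrow>
      c * (\<Sum>n\<in>A. \<bar>r n\<bar>) \<le> restr_norm (closed_span_on x N) (\<Sum>n\<in>A. r n *\<^sub>R xs n)"
  shows "\<exists>C. \<forall>A\<in>\<A>. \<forall>r. (\<forall>n\<in>A. \<bar>r n\<bar> \<le> 1) \<longrightarrow> norm (\<Sum>n\<in>A. r n *\<^sub>R x n) \<le> C"
proof -
  let ?V = "closed_span_on x N"
  \<comment> \<open>If \<open>\<mu>\<close> is the largest modulus of a coefficient of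
    \<open>z'\<close>, attained at \<open>m\<close>, then evaluating \<open>xs m\<close> gives
    \<open>\<mu> * \<epsilon> \<le> 2 + \<mu> * (\<epsilon> / 2)\<close>, that is
    \<open>\<mu> \<le> B\<close>.\<close>
  define B where "B = 4 / \<epsilon>"
  have "B > 0" using \<open>\<epsilon> > 0\<close> by (simp add: B_def)
  \<comment> \<open>The errors at a point of \<open>A - H0\<close> are
    \<open>B * \<eta> = c / 4\<close> off the diagonal, \<open>c / 8\<close> from interpolation and
    \<open>c / 8\<close> from replacing \<open>z\<close> by \<open>z'\<close>; together they make up
    half of \<open>c\<close>.\<close>
  define \<eta> where "\<eta> = c / (4 * B)"
  have "\<eta> > 0" using \<open>B > 0\<close> \<open>c > 0\<close> by (simp add: \<eta>_def)
  obtain H0 where H0: "finite H0"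
    "\<And>m H. m \<in> N - H0 \<Longrightarrow> H \<subseteq> N \<Longrightarrow> finite H \<Longrightarrow> (\<Sum>n\<in>H - {m}. \<bar>blinfun_apply (xs m) (x n)\<bar>) \<le> \<eta>"
    using tails[OF \<open>\<eta> > 0\<close>] by (elim exE conjE) simp
  \<comment> \<open>The value 2 is the bound for \<open>norm z'\<close>, as \<open>z'\<close> lies
    within distance 1 of a vector of the unit ball.\<close>
  obtain C where C: "near_unconditional_on x N (c / 2) B 2 C"
    using uncond[of "c / 2" B 2] \<open>c > 0\<close> by auto
  have xs_sum: "blinfun_apply (xs m) (\<Sum>n\<in>s. b n *\<^sub>R x n) =
      b m * blinfun_apply (xs m) (x m) + (\<Sum>n\<in>s - {m}. b n * blinfun_apply (xs m) (x n))"
    if "finite s" "m \<notin> s \<longrightarrow> b m = 0" for m s and b :: "nat \<Rightarrow> real"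
  proof -
    have "blinfun_apply (xs m) (\<Sum>n\<in>s. b n *\<^sub>R x n) = (\<Sum>n\<in>s. b n * blinfun_apply (xs m) (x n))"
      by (simp add: blinfun.sum_right blinfun.scaleR_right)
    then show ?thesis
      using that by (cases "m \<in> s") (simp_all add: sum.remove[of s m])
  qed
  have off: "\<bar>\<Sum>n\<in>s - {m}. b n * blinfun_apply (xs m) (x n)\<bar>
      \<le> K * (\<Sum>n\<in>s - {m}. \<bar>blinfun_apply (xs m) (x n)\<bar>)"
    if "\<And>n. n \<in> s \<Longrightarrow> \<bar>b n\<bar> \<le> K" for s m K and b :: "nat \<Rightarrow> real"
    unfolding sum_distrib_left using that
    by (intro order_trans[OF sum_abs] sum_mono) (auto simp: abs_mult intro!: mult_right_mono)
  have functional_bound: "(\<Sum>n\<in>A. \<bar>blinfun_apply g (x n)\<bar>) \<le> card H0 + 2 * C / c"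
    if A: "A \<in> \<A>" and g: "norm g \<le> 1" for A and g :: "'a \<Rightarrow>\<^sub>L real"
  proof -
    have "finite A" "A \<subseteq> N" using fin[OF A] by auto
    \<comment> \<open>The signs make the coefficients of \<open>z'\<close> on \<open>A\<close> agree in sign with \<open>g (x n)\<close>.\<close>
    define \<sigma> where "\<sigma> n = (if blinfun_apply g (x n) \<ge> 0 then 1 else - 1 :: real)" for n
    define \<tau> where "\<tau> n = \<sigma> n * sgn (blinfun_apply (xs n) (x n))" for n
    note subspace_closed_span_on[of x N]
    moreover have "\<bar>\<tau> n\<bar> \<le> 1" for n
      by (auto simp: \<tau>_def \<sigma>_def abs_mult sgn_if)
    ultimately obtain z where z: "z \<in> ?V" "norm z \<le> 1"
      "\<And>n. n \<in> A \<Longrightarrow> \<bar>blinfun_apply (xs n) z - c * \<tau> n\<bar> \<le> c / 8"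
      using approximate_interpolation[of ?V A c "c / 8" xs \<tau>, OF _ \<open>finite A\<close> \<open>c > 0\<close> _ ell1[OF A]] \<open>c > 0\<close> by auto
    have "0 < min 1 (c / 8)" using \<open>c > 0\<close> by simp
    then obtain z' where z': "z' \<in> span (x ` N)" "dist z' z < min 1 (c / 8)"
      using z(1)[unfolded closed_span_on_def closure_approachable] by blast
    obtain s b0 where s: "finite s" "s \<subseteq> N" "z' = (\<Sum>n\<in>s. b0 n *\<^sub>R x n)"
      using span_image_sum[OF z'(1)] by (elim exE conjE)
    \<comment> \<open>With the default 0 off \<open>s\<close>, the formula \<open>xs_sum\<close>
      also covers indices outside \<open>s\<close>; a nonzero \<open>b n\<close> later proves
      \<open>n\<close> to be in \<open>s\<close>.\<close>
    define b where "b n = (if n \<in> s then b0 n else 0)" for n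
    have z'_eq: "z' = (\<Sum>n\<in>s. b n *\<^sub>R x n)"
      using s(3) by (simp add: b_def)
    have "norm z' \<le> norm z + dist z' z"
      using norm_triangle_ineq2[of z' z] by (simp add: dist_norm)
    then have z'_norm: "norm z' \<le> 2" using z' z(2) by auto
    have bounded: "\<bar>b n\<bar> \<le> B" if "n \<in> s" for n
    proof -
      define \<mu> where "\<mu> = Max ((\<lambda>n. \<bar>b n\<bar>) ` s)"
      have le: "\<bar>b k\<bar> \<le> \<mu>" if "k \<in> s" for k
        unfolding \<mu>_def using s(1) that by (intro Max_ge) auto
      have "\<mu> \<in> (\<lambda>n. \<bar>b n\<bar>) ` s"
        unfolding \<mu>_def using s(1) that by (intro Max_in) auto
      then obtain m where m: "m \<in> s" "\<bar>b m\<bar> = \<mu>" by auto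
      have "\<mu> * \<epsilon> \<le> \<bar>b m * blinfun_apply (xs m) (x m)\<bar>"
        using m(2) diag[of m] by (auto simp: abs_mult intro!: mult_left_mono)
      also have "\<dots> \<le> \<bar>blinfun_apply (xs m) z'\<bar> + \<bar>\<Sum>n\<in>s - {m}. b n * blinfun_apply (xs m) (x n)\<bar>"
        using xs_sum[of s m b] s(1) m(1) z'_eq by simp
      also have "\<dots> \<le> 2 + \<mu> * (\<epsilon> / 2)"
      proof (rule add_mono)
        show "\<bar>blinfun_apply (xs m) z'\<bar> \<le> 2"
          using abs_blinfun_le[of "xs m" z'] norm_xs z'_norm by simp
        have "\<mu> \<ge> 0" using m(2) by auto
        then have "\<mu> * (\<Sum>n\<in>s - {m}. \<bar>blinfun_apply (xs m) (x n)\<bar>) \<le> \<mu> * (\<epsilon> / 2)"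
          using rows[of m s] m(1) s by (intro mult_left_mono) auto
        then show "\<bar>\<Sum>n\<in>s - {m}. b n * blinfun_apply (xs m) (x n)\<bar> \<le> \<mu> * (\<epsilon> / 2)"
          using off[OF le] by (rule order_trans[rotated])
      qed
      finally have "\<mu> \<le> B"
        using \<open>\<epsilon> > 0\<close> by (simp add: B_def field_simps)
      then show ?thesis using le[OF that] by linarith
    qed
    define F where "F = A - H0"
    have lower: "c / 2 \<le> \<sigma> n * b n \<and> n \<in> s" if "n \<in> F" for n
    proof -
      let ?d = "blinfun_apply (xs n) (x n)"
      have n: "n \<in> A" "n \<in> N - H0" using that \<open>A \<subseteq> N\<close> by (auto simp: F_def)
      let ?err = "\<Sum>k\<in>s - {n}. b k * blinfun_apply (xs n) (x k)"
      have "B * (\<Sum>k\<in>s - {n}. \<bar>blinfun_apply (xs n) (x k)\<bar>) \<le> B * \<eta>"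
        using H0(2)[OF n(2)] s \<open>B > 0\<close> by (intro mult_left_mono) auto
      moreover have "\<bar>?err\<bar> \<le> B * (\<Sum>k\<in>s - {n}. \<bar>blinfun_apply (xs n) (x k)\<bar>)"
        by (rule off[OF bounded])
      ultimately have "\<bar>?err\<bar> \<le> c / 4"
        using \<open>B > 0\<close> by (simp add: \<eta>_def)
      moreover have "\<bar>blinfun_apply (xs n) z' - blinfun_apply (xs n) z\<bar> \<le> c / 8"
        using abs_blinfun_le[of "xs n" "z' - z"] norm_xs z'(2) by (simp add: blinfun.diff_right dist_norm)
      moreover have "\<bar>blinfun_apply (xs n) z - c * \<tau> n\<bar> \<le> c / 8"
        by (rule z(3)[OF n(1)])
      moreover have "blinfun_apply (xs n) z' = b n * ?d + ?err"
        unfolding z'_eq using s(1) by (intro xs_sum) (auto simp: b_def)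
      ultimately have close: "\<bar>b n * ?d - c * \<tau> n\<bar> \<le> c / 2"
        by linarith
      have "?d \<noteq> 0" using diag[of n] \<open>\<epsilon> > 0\<close> by auto
      then have \<tau>1: "\<tau> n * \<tau> n = 1" "\<bar>\<tau> n\<bar> = 1" "\<tau> n * ?d = \<sigma> n * \<bar>?d\<bar>"
        by (auto simp: \<tau>_def \<sigma>_def sgn_if)
      \<comment> \<open>Multiplying by the sign \<open>\<tau> n\<close> shows that
        \<open>\<sigma> n * b n * |?d|\<close> is at least \<open>c / 2\<close>. As
        \<open>|?d|\<close> is at most 1, omitting it does not decrease this positive
        product.\<close>
      have "\<bar>\<tau> n * (b n * ?d - c * \<tau> n)\<bar> \<le> c / 2"
        using close \<tau>1(2) by (simp only: abs_mult) simp
      moreover have "\<tau> n * (b n * ?d - c * \<tau> n) = \<sigma> n * b n * \<bar>?d\<bar> - c"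
      proof -
        have "\<tau> n * (b n * ?d - c * \<tau> n) = b n * (\<tau> n * ?d) - c * (\<tau> n * \<tau> n)"
          by (simp add: algebra_simps)
        then show ?thesis using \<tau>1 by simp
      qed
      ultimately have half: "c / 2 \<le> \<sigma> n * b n * \<bar>?d\<bar>" by linarith
      then have "0 < \<sigma> n * b n * \<bar>?d\<bar>" using \<open>c > 0\<close> by linarith
      then have pos: "0 < \<sigma> n * b n" by (simp add: zero_less_mult_iff)
      have "\<bar>?d\<bar> \<le> 1"
        using abs_blinfun_le[of "xs n" "x n"] norm_x norm_xs by simp
      then have "\<sigma> n * b n * \<bar>?d\<bar> \<le> \<sigma> n * b n * 1"
        using pos by (intro mult_left_mono) auto
      moreover have "n \<in> s" using pos by (auto simp: b_def split: if_splits)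
      ultimately show ?thesis using half by simp
    qed
    have "F \<subseteq> s" using lower by blast
    have "\<forall>n\<in>F. c / 2 \<le> \<bar>b n\<bar>"
    proof
      fix n assume "n \<in> F"
      have "\<sigma> n * b n \<le> \<bar>b n\<bar>" by (auto simp: \<sigma>_def)
      then show "c / 2 \<le> \<bar>b n\<bar>" using lower[OF \<open>n \<in> F\<close>] by linarith
    qed
    then have FC: "norm (\<Sum>n\<in>F. b n *\<^sub>R x n) \<le> C"
      using C[unfolded near_unconditional_on_def, rule_format, of s b F] s z'_eq z'_norm bounded \<open>F \<subseteq> s\<close>
      by auto
    have "c / 2 * (\<Sum>n\<in>F. \<bar>blinfun_apply g (x n)\<bar>) \<le> (\<Sum>n\<in>F. b n * blinfun_apply g (x n))"
      unfolding sum_distrib_left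
    proof (rule sum_mono)
      fix n assume "n \<in> F"
      then have "c / 2 * \<bar>blinfun_apply g (x n)\<bar> \<le> \<sigma> n * b n * \<bar>blinfun_apply g (x n)\<bar>"
        using lower by (intro mult_right_mono) auto
      also have "\<dots> = b n * blinfun_apply g (x n)"
        by (simp add: \<sigma>_def)
      finally show "c / 2 * \<bar>blinfun_apply g (x n)\<bar> \<le> b n * blinfun_apply g (x n)" .
    qed
    also have "\<dots> = blinfun_apply g (\<Sum>n\<in>F. b n *\<^sub>R x n)"
      by (simp add: blinfun.sum_right blinfun.scaleR_right)
    also have "\<dots> \<le> C"
      using abs_blinfun_le[OF g, of "\<Sum>n\<in>F. b n *\<^sub>R x n"] FC by linarith
    finally have tail: "(\<Sum>n\<in>F. \<bar>blinfun_apply g (x n)\<bar>) \<le> 2 * C / c"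
      using \<open>c > 0\<close> by (simp add: field_simps)
    have "(\<Sum>n\<in>A \<inter> H0. \<bar>blinfun_apply g (x n)\<bar>) \<le> (\<Sum>n\<in>A \<inter> H0. 1)"
      using abs_blinfun_le[OF g] norm_x by (intro sum_mono) (metis)
    also have "\<dots> \<le> card H0"
      using card_mono[OF H0(1), of "A \<inter> H0"] by simp
    finally show ?thesis
      using tail sum.Int_Diff[OF \<open>finite A\<close>, of "\<lambda>n. \<bar>blinfun_apply g (x n)\<bar>" H0]
      by (simp add: F_def)
  qed
  have "norm (\<Sum>n\<in>A. r n *\<^sub>R x n) \<le> card H0 + 2 * C / c"
    if A: "A \<in> \<A>" and r: "\<forall>n\<in>A. \<bar>r n\<bar> \<le> 1" for A r
  proof -
    obtain g :: "'a \<Rightarrow>\<^sub>L real" where g: "norm g \<le> 1"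
      "blinfun_apply g (\<Sum>n\<in>A. r n *\<^sub>R x n) = norm (\<Sum>n\<in>A. r n *\<^sub>R x n)"
      using norming_functional by blast
    have "norm (\<Sum>n\<in>A. r n *\<^sub>R x n) = (\<Sum>n\<in>A. r n * blinfun_apply g (x n))"
      using g(2) by (simp add: blinfun.sum_right blinfun.scaleR_right)
    also have "\<dots> \<le> (\<Sum>n\<in>A. \<bar>blinfun_apply g (x n)\<bar>)"
    proof (rule sum_mono)
      fix n assume "n \<in> A"
      then have "\<bar>r n\<bar> * \<bar>blinfun_apply g (x n)\<bar> \<le> 1 * \<bar>blinfun_apply g (x n)\<bar>"
        using r by (intro mult_right_mono) auto
      then show "r n * blinfun_apply g (x n) \<le> \<bar>blinfun_apply g (x n)\<bar>"
        using abs_ge_self[of "r n * blinfun_apply g (x n)"] by (simp add: abs_mult)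
    qed
    also have "\<dots> \<le> card H0 + 2 * C / c"
      using functional_bound[OF A g(1)] .
    finally show ?thesis .
  qed
  then show ?thesis by blast
qed

text \<open>The signs \<open>\<sigma>\<close> turn every diagonal term into
  \<open>|r n| * |xs n (x n)|\<close>, of which diagonal dominance preserves at least
  \<open>\<epsilon> / 2 * |r n|\<close>. By \<open>c0\<close> the test vector \<open>z\<close>,
  divided by \<open>C\<close>, lies in the unit ball of \<open>V\<close>.\<close>

lemma ell1_estimate_from_c0:
  fixes x :: "nat \<Rightarrow> 'a::real_normed_vector" and xs :: "nat \<Rightarrow> ('a \<Rightarrow>\<^sub>L real)"
  assumes diag: "\<And>n. n \<in> A \<Longrightarrow> \<epsilon> \<le> \<bar>blinfun_apply (xs n) (x n)\<bar>"
    and rows: "\<And>m. m \<in> A \<Longrightarrow> (\<Sum>n\<in>A - {m}. \<bar>blinfun_apply (xs m) (x n)\<bar>) \<le> \<epsilon> / 2"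
    and "C > 0" "finite A" and V: "subspace V" "x ` A \<subseteq> V"
    and c0: "\<And>r. (\<forall>n\<in>A. \<bar>r n\<bar> \<le> 1) \<Longrightarrow> norm (\<Sum>n\<in>A. r n *\<^sub>R x n) \<le> C"
  shows "\<epsilon> / (2 * C) * (\<Sum>n\<in>A. \<bar>r n\<bar>) \<le> restr_norm V (\<Sum>n\<in>A. r n *\<^sub>R xs n)"
proof -
  define \<sigma> where "\<sigma> n = sgn (r n) * sgn (blinfun_apply (xs n) (x n))" for n
  have \<sigma>1: "\<bar>\<sigma> n\<bar> \<le> 1" for n
    by (auto simp: \<sigma>_def sgn_if)
  define z where "z = (\<Sum>n\<in>A. \<sigma> n *\<^sub>R x n)"
  have "norm z \<le> C"
    unfolding z_def using \<sigma>1 by (intro c0) auto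
  have "z \<in> V"
    unfolding z_def using V by (intro subspace_sum subspace_scale) auto
  have term_bound: "\<epsilon> / 2 * \<bar>r n\<bar> \<le> r n * blinfun_apply (xs n) z" if "n \<in> A" for n
  proof -
    let ?d = "blinfun_apply (xs n) (x n)"
    let ?err = "\<Sum>k\<in>A - {n}. \<sigma> k * blinfun_apply (xs n) (x k)"
    have "blinfun_apply (xs n) z = \<sigma> n * ?d + ?err"
    proof -
      have "blinfun_apply (xs n) z = (\<Sum>k\<in>A. \<sigma> k * blinfun_apply (xs n) (x k))"
        by (simp add: z_def blinfun.sum_right blinfun.scaleR_right)
      then show ?thesis
        using sum.remove[OF assms(4) that] by simp
    qed
    moreover have "r n * (\<sigma> n * ?d) = \<bar>r n\<bar> * \<bar>?d\<bar>"
      by (auto simp: \<sigma>_def sgn_if)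
    ultimately have "r n * blinfun_apply (xs n) z = \<bar>r n\<bar> * \<bar>?d\<bar> + r n * ?err"
      by (simp add: distrib_left)
    moreover have "\<bar>?err\<bar> \<le> \<epsilon> / 2"
    proof -
      have "\<bar>?err\<bar> \<le> (\<Sum>k\<in>A - {n}. 1 * \<bar>blinfun_apply (xs n) (x k)\<bar>)"
        using \<sigma>1 by (intro order_trans[OF sum_abs] sum_mono) (auto simp: abs_mult intro!: mult_left_le_one_le)
      then show ?thesis using rows[OF that] by simp
    qed
    then have "\<bar>r n\<bar> * \<bar>?err\<bar> \<le> \<bar>r n\<bar> * (\<epsilon> / 2)"
      by (intro mult_left_mono) auto
    then have "- (\<bar>r n\<bar> * (\<epsilon> / 2)) \<le> r n * ?err"
      using abs_ge_minus_self[of "r n * ?err"] by (simp add: abs_mult)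
    moreover have "\<bar>r n\<bar> * \<epsilon> \<le> \<bar>r n\<bar> * \<bar>?d\<bar>"
      using diag[OF that] by (intro mult_left_mono) auto
    ultimately show ?thesis by (simp add: algebra_simps)
  qed
  have "\<epsilon> / (2 * C) * (\<Sum>n\<in>A. \<bar>r n\<bar>) = (\<Sum>n\<in>A. \<epsilon> / 2 * \<bar>r n\<bar>) / C"
    by (simp only: sum_distrib_left[symmetric]) simp
  also have "\<dots> \<le> (\<Sum>n\<in>A. r n * blinfun_apply (xs n) z) / C"
    using \<open>C > 0\<close> by (intro divide_right_mono sum_mono term_bound) auto
  also have "\<dots> = blinfun_apply (\<Sum>n\<in>A. r n *\<^sub>R xs n) (z /\<^sub>R C)"
    by (simp add: blinfun.sum_left blinfun.scaleR_left blinfun.scaleR_right divide_inverse sum_distrib_left mult_ac)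
  also have "\<dots> \<le> \<bar>blinfun_apply (\<Sum>n\<in>A. r n *\<^sub>R xs n) (z /\<^sub>R C)\<bar>" by simp
  also have "\<dots> \<le> restr_norm V (\<Sum>n\<in>A. r n *\<^sub>R xs n)"
    using \<open>norm z \<le> C\<close> \<open>z \<in> V\<close> \<open>C > 0\<close> V(1)
    by (intro restr_norm_ge) (auto intro: subspace_scale simp: field_simps)
  finally show ?thesis .
qed

section \<open>Schreier families\<close>

lemma opred_less:
  assumes "is_succ_ord \<xi>"
  shows "opred \<xi> < \<xi>"
proof -
  obtain \<eta> where \<eta>: "\<eta> < \<xi>" "\<forall>\<zeta>. \<eta> < \<zeta> \<longrightarrow> \<xi> \<le> \<zeta>"
    using assms by (auto simp: is_succ_ord_def)
  have "opred \<xi> = \<eta>"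
    unfolding opred_def
  proof (rule the_equality)
    show "\<eta>' = \<eta>" if "\<eta>' < \<xi> \<and> (\<forall>\<zeta>. \<eta>' < \<zeta> \<longrightarrow> \<xi> \<le> \<zeta>)" for \<eta>'
      using that \<eta> by (metis leD linorder_less_linear)
  qed (use \<eta> in blast)
  then show ?thesis using \<eta> by simp
qed

text \<open>Strictness comes from the next term: \<open>osuc (\<beta> \<eta> n)\<close> is below
  \<open>osuc (\<beta> \<eta> (Suc n))\<close>, which is at most \<open>\<eta>\<close>. So the
  recursion at limits only calls smaller ordinals.\<close>

lemma osuc_beta_less:
  assumes "valid_beta \<beta> \<xi>" "\<eta> \<le> \<xi>" "is_limit_ord \<eta>" "n \<ge> 1"
  shows "osuc (\<beta> \<eta> n) < \<eta>"
proof -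
  have beta: "\<beta> \<eta> m < \<eta> \<and> osuc (\<beta> \<eta> m) < osuc (\<beta> \<eta> (Suc m))" if "m \<ge> 1" for m
    using assms that unfolding valid_beta_def by blast
  have "osuc (\<beta> \<eta> (Suc n)) \<le> \<eta>"
    unfolding osuc_def using beta[of "Suc n"] by (intro Least_le) simp
  then show ?thesis
    using beta[OF assms(4)] by (auto dest: less_le_trans)
qed

lemma schreier_unfold: "schreier \<beta> \<eta> = schreier_step \<beta> (cut (schreier \<beta>) {(a, b). a < b} \<eta>) \<eta>"
  unfolding schreier_def by (rule wfrec[OF wf])

text \<open>Supplies what the passage to index sets requires: finite sums, and positions that start
  at 1.\<close>

lemma schreier_finite_pos:
  assumes "valid_beta \<beta> \<xi>" "\<eta> \<le> \<xi>" "F \<in> schreier \<beta> \<eta>"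
  shows "finite F \<and> 0 \<notin> F"
  using assms(2,3)
proof (induction \<eta> arbitrary: F rule: less_induct)
  case (less \<eta>)
  let ?S = "cut (schreier \<beta>) {(a, b). a < b} \<eta>"
  have S: "?S \<zeta> = schreier \<beta> \<zeta>" if "\<zeta> < \<eta>" for \<zeta>
    using that by (simp add: cut_apply)
  have F: "F \<in> schreier_step \<beta> ?S \<eta>"
    using less.prems(2) by (subst (asm) schreier_unfold)
  consider "is_zero_ord \<eta>" | "\<not> is_zero_ord \<eta>" "is_succ_ord \<eta>" | "is_limit_ord \<eta>" "\<not> is_zero_ord \<eta>" "\<not> is_succ_ord \<eta>"
    by (auto simp: is_limit_ord_def)
  then show ?case
  proof cases
    case 1
    then show ?thesis using F by (auto simp: schreier_step_def)
  next
    case 2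
    have "finite G \<and> 0 \<notin> G" if "G \<in> ?S (opred \<eta>)" for G
      using less.IH[of "opred \<eta>" G] that opred_less[OF 2(2)] less.prems(1) S by simp
    then show ?thesis
      using F 2 by (fastforce simp: schreier_step_def)
  next
    case 3
    have "finite G \<and> 0 \<notin> G" if "n \<ge> 1" "G \<in> ?S (osuc (\<beta> \<eta> n))" for n G
      using less.IH[of "osuc (\<beta> \<eta> n)" G] that osuc_beta_less[OF assms(1) less.prems(1) 3(1) that(1)]
        less.prems(1) S by simp
    then show ?thesis
      using F 3 by (auto simp: schreier_step_def)
  qed
qed

section \<open>From positions in a subsequence to sets of indices\<close>

lemma inj_on_enumerate_pred:
  assumes "infinite L" "0 \<notin> F"
  shows "inj_on (\<lambda>i. enumerate L (i - 1)) F"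
proof (rule inj_onI)
  fix i j assume ij: "i \<in> F" "j \<in> F" "enumerate L (i - 1) = enumerate L (j - 1)"
  then have "i - 1 = j - 1"
    using inj_enumerate[OF assms(1)] by (simp add: inj_eq)
  \<comment> \<open>Truncated subtraction sends both 0 and 1 to 0, so injectivity depends on the
    absence of 0.\<close>
  moreover have "i \<noteq> 0" "j \<noteq> 0" using ij(1,2) assms(2) by metis+
  ultimately show "i = j" by simp
qed

text \<open>Moves the sets of positions into \<open>L\<close> and indexes coefficients by elements
  of \<open>L\<close>, so that the duality estimates never meet the enumeration. Injectivity permits
  carrying coefficients back through \<open>inv_into\<close>.\<close>

lemma ell1_spreading_subseq_iff:
  fixes z :: "nat \<Rightarrow> 'b::real_vector"
  assumes L: "infinite L" and SF: "\<forall>F\<in>SF. finite F \<and> 0 \<notin> F"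
  shows "ell1_spreading SF nrm (subseq_on L z) \<longleftrightarrow> seminormalized nrm (subseq_on L z) \<and>
    (\<exists>c>0. \<forall>A\<in>(\<lambda>F. (\<lambda>i. enumerate L (i - 1)) ` F) ` SF. \<forall>r. c * (\<Sum>n\<in>A. \<bar>r n\<bar>) \<le> nrm (\<Sum>n\<in>A. r n *\<^sub>R z n))"
proof -
  let ?e = "\<lambda>i. enumerate L (i - 1)"
  have "(\<forall>a. c * (\<Sum>i\<in>F. \<bar>a i\<bar>) \<le> nrm (\<Sum>i\<in>F. a i *\<^sub>R subseq_on L z i)) \<longleftrightarrow>
      (\<forall>r. c * (\<Sum>n\<in>?e ` F. \<bar>r n\<bar>) \<le> nrm (\<Sum>n\<in>?e ` F. r n *\<^sub>R z n))"
    if "F \<in> SF" for F and c :: real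
  proof -
    have inj: "inj_on ?e F"
      using inj_on_enumerate_pred[OF L] bspec[OF SF that] by blast
    have inv: "inv_into F ?e (?e i) = i" if "i \<in> F" for i
      using inv_into_f_f[OF inj that] .
    have inv_sums: "(\<Sum>i\<in>F. \<bar>a (inv_into F ?e (?e i))\<bar>) = (\<Sum>i\<in>F. \<bar>a i\<bar>)"
      "(\<Sum>i\<in>F. a (inv_into F ?e (?e i)) *\<^sub>R z (?e i)) = (\<Sum>i\<in>F. a i *\<^sub>R subseq_on L z i)" for a
      unfolding subseq_on_def by (auto intro!: sum.cong simp only: inv)
    show ?thesis
    proof (intro iffI allI)
      fix r
      assume "\<forall>a. c * (\<Sum>i\<in>F. \<bar>a i\<bar>) \<le> nrm (\<Sum>i\<in>F. a i *\<^sub>R subseq_on L z i)"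
      then show "c * (\<Sum>n\<in>?e ` F. \<bar>r n\<bar>) \<le> nrm (\<Sum>n\<in>?e ` F. r n *\<^sub>R z n)"
        unfolding sum.reindex[OF inj] o_def subseq_on_def by (rule allE[of _ "\<lambda>i. r (?e i)"])
    next
      fix a
      assume "\<forall>r. c * (\<Sum>n\<in>?e ` F. \<bar>r n\<bar>) \<le> nrm (\<Sum>n\<in>?e ` F. r n *\<^sub>R z n)"
      then have "c * (\<Sum>n\<in>?e ` F. \<bar>a (inv_into F ?e n)\<bar>) \<le> nrm (\<Sum>n\<in>?e ` F. a (inv_into F ?e n) *\<^sub>R z n)"
        by (rule allE)
      then show "c * (\<Sum>i\<in>F. \<bar>a i\<bar>) \<le> nrm (\<Sum>i\<in>F. a i *\<^sub>R subseq_on L z i)"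
        unfolding sum.reindex[OF inj] o_def inv_sums .
    qed
  qed
  then show ?thesis
    unfolding ell1_spreading_def by (simp add: cong: conj_cong)
qed

text \<open>Besides the change of indices, homogeneity replaces the maximum of the coefficients by
  the normalisation to modulus at most 1. The constant \<open>|C| + 1\<close> restores the
  positivity that the definition demands.\<close>

lemma c0_spreading_subseq_iff:
  fixes z :: "nat \<Rightarrow> 'b::real_normed_vector"
  assumes L: "infinite L" and SF: "\<forall>F\<in>SF. finite F \<and> 0 \<notin> F"
  shows "c0_spreading SF norm (subseq_on L z) \<longleftrightarrow> seminormalized norm (subseq_on L z) \<and>
    (\<exists>C. \<forall>A\<in>(\<lambda>F. (\<lambda>i. enumerate L (i - 1)) ` F) ` SF. \<forall>r. (\<forall>n\<in>A. \<bar>r n\<bar> \<le> 1) \<longrightarrow>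
       norm (\<Sum>n\<in>A. r n *\<^sub>R z n) \<le> C)"
    (is "_ \<longleftrightarrow> _ \<and> (\<exists>C. ?P C)")
proof -
  let ?e = "\<lambda>i. enumerate L (i - 1)"
  have inj: "inj_on ?e F" if "F \<in> SF" for F
    using inj_on_enumerate_pred[OF L] bspec[OF SF that] by blast
  have "?P C" if "C > 0" and C: "\<forall>F\<in>SF. F \<noteq> {} \<longrightarrow> (\<forall>a. norm (\<Sum>i\<in>F. a i *\<^sub>R subseq_on L z i) \<le>
      C * Max ((\<lambda>i. \<bar>a i\<bar>) ` F))" for C
  proof (intro ballI allI impI)
    fix A and r :: "nat \<Rightarrow> real"
    assume "A \<in> (\<lambda>F. ?e ` F) ` SF" and r: "\<forall>n\<in>A. \<bar>r n\<bar> \<le> 1"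
    then obtain F where F: "F \<in> SF" "A = ?e ` F" by blast
    show "norm (\<Sum>n\<in>A. r n *\<^sub>R z n) \<le> C"
    proof (cases "F = {}")
      case True
      then show ?thesis using F(2) \<open>C > 0\<close> by simp
    next
      case False
      have "norm (\<Sum>n\<in>A. r n *\<^sub>R z n) = norm (\<Sum>i\<in>F. r (?e i) *\<^sub>R subseq_on L z i)"
        by (simp only: F(2) sum.reindex[OF inj[OF F(1)]] subseq_on_def o_def)
      also have "\<dots> \<le> C * Max ((\<lambda>i. \<bar>r (?e i)\<bar>) ` F)"
        using C[rule_format, OF F(1) False, of "\<lambda>i. r (?e i)"] .
      also have "\<dots> \<le> C * 1"
        using F bspec[OF SF F(1)] False r \<open>C > 0\<close> by (intro mult_left_mono) auto
      finally show ?thesis by simp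
    qed
  qed
  moreover have "norm (\<Sum>i\<in>F. a i *\<^sub>R subseq_on L z i) \<le> (\<bar>C\<bar> + 1) * Max ((\<lambda>i. \<bar>a i\<bar>) ` F)"
    if C: "?P C" and F: "F \<in> SF" "F \<noteq> {}" for C F a
  proof -
    define m where "m = Max ((\<lambda>i. \<bar>a i\<bar>) ` F)"
    have le: "\<bar>a i\<bar> \<le> m" if "i \<in> F" for i
      unfolding m_def using bspec[OF SF F(1)] that by (intro Max_ge) auto
    show ?thesis
    \<comment> \<open>Dividing by the maximum \<open>m\<close> normalises the coefficients; if
      \<open>m\<close> is 0, they all vanish.\<close>
    proof (cases "m > 0")
      case True
      define r where "r n = a (inv_into F ?e n) / m" for n
      have re: "r (?e i) = a i / m" if "i \<in> F" for i
        unfolding r_def using inv_into_f_f[OF inj[OF F(1)] that] by simp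
      have "\<forall>n\<in>?e ` F. \<bar>r n\<bar> \<le> 1"
        using re le True by auto
      then have "norm (\<Sum>n\<in>?e ` F. r n *\<^sub>R z n) \<le> C"
        using C F(1) by blast
      moreover have "(\<Sum>n\<in>?e ` F. r n *\<^sub>R z n) = (\<Sum>i\<in>F. (a i / m) *\<^sub>R z (?e i))"
        unfolding sum.reindex[OF inj[OF F(1)]] o_def using re by (intro sum.cong) auto
      moreover have "(\<Sum>i\<in>F. a i *\<^sub>R subseq_on L z i) = m *\<^sub>R (\<Sum>i\<in>F. (a i / m) *\<^sub>R z (?e i))"
        using True by (simp add: scaleR_sum_right subseq_on_def)
      ultimately have "norm (\<Sum>i\<in>F. a i *\<^sub>R subseq_on L z i) \<le> m * C"
        using True by simp
      also have "\<dots> \<le> (\<bar>C\<bar> + 1) * m"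
        using True by (simp add: mult.commute[of m] mult_right_mono)
      finally show ?thesis by (simp add: m_def)
    next
      case False
      have "a i = 0" if "i \<in> F" for i
        using le[OF that] False by linarith
      moreover have "m = 0"
        using False F(2) le abs_ge_zero by (metis all_not_in_conv linorder_neqE_linordered_idom not_le order_trans)
      ultimately show ?thesis by (simp add: m_def)
    qed
  qed
  moreover have "0 < \<bar>C\<bar> + 1" for C :: real by simp
  ultimately have "(\<exists>C>0. \<forall>F\<in>SF. F \<noteq> {} \<longrightarrow> (\<forall>a. norm (\<Sum>i\<in>F. a i *\<^sub>R subseq_on L z i) \<le>
      C * Max ((\<lambda>i. \<bar>a i\<bar>) ` F))) \<longleftrightarrow> (\<exists>C. ?P C)"
    by (intro iffI; elim exE conjE) (rule exI, blast, rule exI, blast)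
  then show ?thesis
    unfolding c0_spreading_def by (rule arg_cong)
qed

theorem theorem3p9:
  fixes x :: "nat \<Rightarrow> 'a::banach"
    and xs :: "nat \<Rightarrow> ('a \<Rightarrow>\<^sub>L real)"
    and \<epsilon> :: real
    and \<xi> :: "'o::wellorder"
    and \<beta> :: "'o \<Rightarrow> nat \<Rightarrow> 'o"
  assumes norm_x: "\<forall>n. norm (x n) = 1"
    and norm_xs: "\<forall>n. norm (xs n) = 1"
    and wn_x: "weakly_null x"
    and wn_xs: "weakly_null xs"
    and eps_pos: "\<epsilon> > 0"
    and eps_bound: "\<forall>n. \<bar>blinfun_apply (xs n) (x n)\<bar> \<ge> \<epsilon>"
    and xi_countable: "countable {..\<xi>}"
    and xi_ge1: "\<not> is_zero_ord \<xi>"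
    and beta: "valid_beta \<beta> \<xi>"
  shows "(\<forall>M. infinite M \<longrightarrow> (\<exists>L\<subseteq>M. infinite L \<and>
             ell1_spreading (schreier \<beta> \<xi>) (restr_norm (closed_span_on x M)) (subseq_on L xs)))
     \<longleftrightarrow> (\<forall>M. infinite M \<longrightarrow> (\<exists>L\<subseteq>M. infinite L \<and>
             c0_spreading (schreier \<beta> \<xi>) norm (subseq_on L x)))"
proof -
  let ?S = "schreier \<beta> \<xi>"
  let ?\<A> = "\<lambda>L :: nat set. (\<lambda>F. (\<lambda>i. enumerate L (i - 1)) ` F) ` ?S"
  have S: "\<forall>F\<in>?S. finite F \<and> 0 \<notin> F"
    using schreier_finite_pos[OF beta order_refl] by blast
  have \<A>: "finite A \<and> A \<subseteq> L" if "infinite L" "A \<in> ?\<A> L" for A L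
    using that S enumerate_in_set[OF that(1)] by auto
  have rows: "(\<lambda>n. \<bar>blinfun_apply (xs p) (x n)\<bar>) \<longlonglongrightarrow> 0" for p
    using wn_x bounded_linear_blinfun_apply[OF bounded_linear_ident, of "xs p"]
    by (intro tendsto_rabs_zero) (auto simp: weakly_null_def)
  \<comment> \<open>Evaluation at \<open>x p\<close> is a bounded linear functional on the dual
    space, so columns tend to 0 by weak nullness of \<open>xs\<close>, as rows do by that of
    \<open>x\<close>.\<close>
  have cols: "(\<lambda>n. \<bar>blinfun_apply (xs n) (x p)\<bar>) \<longlonglongrightarrow> 0" for p
    using wn_xs blinfun.bounded_linear_left[of "x p"]
    by (intro tendsto_rabs_zero) (auto simp: weakly_null_def)
  have sparse: "\<exists>N\<subseteq>M. infinite N \<and>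
      (\<forall>m\<in>N. \<forall>H\<subseteq>N. finite H \<longrightarrow> (\<Sum>n\<in>H - {m}. \<bar>blinfun_apply (xs m) (x n)\<bar>) \<le> \<epsilon> / 2) \<and>
      (\<forall>\<eta>>0. \<exists>H0. finite H0 \<and> (\<forall>m\<in>N - H0. \<forall>H\<subseteq>N. finite H \<longrightarrow>
         (\<Sum>n\<in>H - {m}. \<bar>blinfun_apply (xs m) (x n)\<bar>) \<le> \<eta>))" if "infinite M" for M
    using small_off_diagonal[of "\<lambda>m n. \<bar>blinfun_apply (xs m) (x n)\<bar>" "\<epsilon> / 2", OF _ rows cols _ that] eps_pos
    by simp
  show ?thesis
  proof (intro iffI allI impI)
    fix M :: "nat set"
    assume ell1: "\<forall>M. infinite M \<longrightarrow> (\<exists>L\<subseteq>M. infinite L \<and>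
      ell1_spreading ?S (restr_norm (closed_span_on x M)) (subseq_on L xs))" and "infinite M"
    obtain M' where M': "M' \<subseteq> M" "infinite M'"
      and M'_rows: "\<And>m H. m \<in> M' \<Longrightarrow> H \<subseteq> M' \<Longrightarrow> finite H \<Longrightarrow> (\<Sum>n\<in>H - {m}. \<bar>blinfun_apply (xs m) (x n)\<bar>) \<le> \<epsilon> / 2"
      and M'_tails: "\<And>\<eta>. \<eta> > 0 \<Longrightarrow> \<exists>H0. finite H0 \<and> (\<forall>m\<in>M' - H0. \<forall>H\<subseteq>M'. finite H \<longrightarrow>
         (\<Sum>n\<in>H - {m}. \<bar>blinfun_apply (xs m) (x n)\<bar>) \<le> \<eta>)"
      using sparse[OF \<open>infinite M\<close>] by (elim exE conjE) simp
    obtain N where N: "N \<subseteq> M'" "infinite N"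
      and uncond: "\<And>\<delta> B R. \<delta> > 0 \<Longrightarrow> \<exists>C. near_unconditional_on x N \<delta> B R C"
      using near_unconditional_subsequence[OF wn_x _ M'(2)] norm_x by (metis order_refl)
    \<comment> \<open>The hypothesis is applied to \<open>N\<close>, not to \<open>M\<close>: the
      interpolating vectors then lie in the closed span of the \<open>x n\<close> with
      \<open>n\<close> in \<open>N\<close>, where near diagonality and Elton's property are
      available.\<close>
    obtain L where L: "L \<subseteq> N" "infinite L"
      and spread: "ell1_spreading ?S (restr_norm (closed_span_on x N)) (subseq_on L xs)"
      using ell1 N(2) by blast
    obtain c where c: "c > 0" "\<And>A r. A \<in> ?\<A> L \<Longrightarrow>
        c * (\<Sum>n\<in>A. \<bar>r n\<bar>) \<le> restr_norm (closed_span_on x N) (\<Sum>n\<in>A. r n *\<^sub>R xs n)"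
      using iffD1[OF ell1_spreading_subseq_iff[OF L(2) S] spread] by (elim exE conjE) blast
    have N_tails: "\<exists>H0. finite H0 \<and> (\<forall>m\<in>N - H0. \<forall>H\<subseteq>N. finite H \<longrightarrow>
         (\<Sum>n\<in>H - {m}. \<bar>blinfun_apply (xs m) (x n)\<bar>) \<le> \<eta>)" if "\<eta> > 0" for \<eta>
      using M'_tails[OF that] N(1) by (meson DiffD1 DiffD2 DiffI subset_eq subset_trans)
    have "\<exists>C. \<forall>A\<in>?\<A> L. \<forall>r. (\<forall>n\<in>A. \<bar>r n\<bar> \<le> 1) \<longrightarrow> norm (\<Sum>n\<in>A. r n *\<^sub>R x n) \<le> C"
    proof (rule c0_estimate_from_ell1[where N = N and c = c])
      show "c * (\<Sum>n\<in>A. \<bar>r n\<bar>) \<le> restr_norm (closed_span_on x N) (\<Sum>n\<in>A. r n *\<^sub>R xs n)"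
        if "A \<in> ?\<A> L" for A r
        by (rule c(2)[OF that])
      show "(\<Sum>n\<in>H - {m}. \<bar>blinfun_apply (xs m) (x n)\<bar>) \<le> \<epsilon> / 2"
        if "m \<in> N" "H \<subseteq> N" "finite H" for m H
        using that N(1) by (intro M'_rows) auto
      show "finite A \<and> A \<subseteq> N" if "A \<in> ?\<A> L" for A
        using \<A>[OF L(2) that] L(1) by blast
    qed (use norm_x norm_xs eps_pos eps_bound N_tails uncond c(1) in auto)
    moreover have "seminormalized norm (subseq_on L x)"
      using norm_x by (auto simp: seminormalized_def subseq_on_def intro!: exI[of _ 1])
    ultimately have "c0_spreading ?S norm (subseq_on L x)"
      unfolding c0_spreading_subseq_iff[OF L(2) S] by blast
    then show "\<exists>L\<subseteq>M. infinite L \<and> c0_spreading ?S norm (subseq_on L x)"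
      using L N M' by blast
  next
    fix M :: "nat set"
    assume c0: "\<forall>M. infinite M \<longrightarrow> (\<exists>L\<subseteq>M. infinite L \<and> c0_spreading ?S norm (subseq_on L x))"
      and "infinite M"
    let ?V = "closed_span_on x M"
    obtain N where N: "N \<subseteq> M" "infinite N"
      and N_rows: "\<And>m H. m \<in> N \<Longrightarrow> H \<subseteq> N \<Longrightarrow> finite H \<Longrightarrow> (\<Sum>n\<in>H - {m}. \<bar>blinfun_apply (xs m) (x n)\<bar>) \<le> \<epsilon> / 2"
      using sparse[OF \<open>infinite M\<close>] by (elim exE conjE) simp
    obtain L where L: "L \<subseteq> N" "infinite L" and spread: "c0_spreading ?S norm (subseq_on L x)"
      using c0 N(2) by blast
    obtain C where C: "\<And>A r. A \<in> ?\<A> L \<Longrightarrow> (\<forall>n\<in>A. \<bar>r n\<bar> \<le> 1) \<Longrightarrow> norm (\<Sum>n\<in>A. r n *\<^sub>R x n) \<le> C"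
      using iffD1[OF c0_spreading_subseq_iff[OF L(2) S] spread] by (elim exE conjE) blast
    \<comment> \<open>A positive bound is required, since the test vector is divided by it.\<close>
    define C' where "C' = \<bar>C\<bar> + 1"
    have "\<epsilon> / (2 * C') * (\<Sum>n\<in>A. \<bar>r n\<bar>) \<le> restr_norm ?V (\<Sum>n\<in>A. r n *\<^sub>R xs n)"
      if A: "A \<in> ?\<A> L" for A r
    proof (rule ell1_estimate_from_c0[OF _ _ _ _ subspace_closed_span_on])
      show "(\<Sum>n\<in>A - {m}. \<bar>blinfun_apply (xs m) (x n)\<bar>) \<le> \<epsilon> / 2" if "m \<in> A" for m
        using \<A>[OF L(2) A] L(1) that by (intro N_rows) auto
      show "x ` A \<subseteq> ?V"
        using \<A>[OF L(2) A] L(1) N(1) in_closed_span_on by blast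
      show "norm (\<Sum>n\<in>A. r n *\<^sub>R x n) \<le> C'" if "\<forall>n\<in>A. \<bar>r n\<bar> \<le> 1" for r
        using C[OF A that] by (simp add: C'_def)
    qed (use \<A>[OF L(2) A] eps_bound in \<open>auto simp: C'_def\<close>)
    moreover have "\<epsilon> / (2 * C') > 0"
      using eps_pos by (simp add: C'_def)
    moreover have "seminormalized (restr_norm ?V) (subseq_on L xs)"
      unfolding seminormalized_def
    proof (intro exI conjI allI impI)
      fix i :: nat
      let ?n = "enumerate L (i - 1)"
      \<comment> \<open>Testing at \<open>x ?n\<close>, a unit vector of \<open>?V\<close>, gives
        the lower bound \<open>\<epsilon>\<close>.\<close>
      have "?n \<in> M" using enumerate_in_set[OF L(2)] L(1) N(1) by blast
      then have "\<bar>blinfun_apply (xs ?n) (x ?n)\<bar> \<le> restr_norm ?V (xs ?n)"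
        using norm_x by (intro restr_norm_ge in_closed_span_on) auto
      then show "\<epsilon> \<le> restr_norm ?V (subseq_on L xs i)"
        using eps_bound by (auto simp: subseq_on_def intro: order_trans)
      show "restr_norm ?V (subseq_on L xs i) \<le> 1"
      proof (rule restr_norm_le[OF subspace_0[OF subspace_closed_span_on]])
        fix v :: 'a assume "norm v \<le> 1"
        then show "\<bar>blinfun_apply (subseq_on L xs i) v\<bar> \<le> 1"
          using abs_blinfun_le[of "subseq_on L xs i" v] norm_xs by (simp add: subseq_on_def)
      qed
    qed (rule eps_pos)
    ultimately have "ell1_spreading ?S (restr_norm ?V) (subseq_on L xs)"
      unfolding ell1_spreading_subseq_iff[OF L(2) S] by blast
    then show "\<exists>L\<subseteq>M. infinite L \<and> ell1_spreading ?S (restr_norm ?V) (subseq_on L xs)"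
      using L N by blast
  qed
qed

end
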